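(* Let $G$ be a finite subgroup of the orthogonal group $O(\mathbb{R}^n)$ and let $t$ be a positive integer. Let $X=\bigcup_{k=1}^M r_k x_k^G$, where $x_k\in S^{n-1}$ (the unit sphere of $\mathbb{R}^n$), $r_k>0$, and $x_k^G$ denotes the $G$-orbit of $x_k$ (the radii $r_k$ are not required to be mutually distinct). Let $w:X\to(0,\infty)$ be a weight function that is constant on each $G$-orbit contained in $X$. Then the following are equivalent: (1) $X$ is a $G$-invariant Euclidean $t$-design with weight function $w$. (2) $\sum_{x\in X} w(x)\,\|x\|^{2j}\varphi(x)=0$ for every $\varphi\in \mathrm{Harm}_l(\mathbb{R}^n)^G$ and all integers $l,j$ with $1\le l\le t$ and $0\le j\le \lfloor \frac{t-l}{2}\rfloor$.
   Context: $\mathrm{Harm}_l(\mathbb{R}^n)$ is the space of real harmonic homogeneous polynomials of degree $l$ in $n$ variables; $G$ acts on polynomials by $(\sigma f)(x)=f(x^{\sigma^{-1}})$, where $x^{\sigma}$ denotes the image of $x$ under $\sigma\in G$, and $\mathrm{Harm}_l(\mathbb{R}^n)^G$ is the subspace of polynomials $f\in \mathrm{Harm}_l(\mathbb{R}^n)$ with $\sigma f=f$ for all $\sigma\in G$. Euclidean design: let $X\subset\mathbb{R}^n$ be a finite set, let $\rho_1,\dots,\rho_p$ be the distinct norms of the vectors of $X$, let $S_i$ be the sphere of radius $\rho_i$ centered at the origin, $S=\bigcup_{i=1}^p S_i$, and $X_i=X\cap S_i$. Then $X$ is a Euclidean $t$-design (supported by $S$) with weight function $w:X\to(0,\infty)$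 if $$\sum_{i=1}^p \Big(\sum_{x\in X_i} w(x)\Big)\frac{1}{|S_i|}\int_{S_i} f\,d\sigma_i=\sum_{x\in X} w(x)f(x)$$ for every polynomial $f$ in $n$ variables of degree at most $t$, where $\sigma_i$ is the surface measure on $S_i$ and $|S_i|=\sigma_i(S_i)$ (if $S_i=\{0\}$, the average is read as $f(0)$). A Euclidean $t$-design with weight function $w$ is $G$-invariant if $X$ is a union of $G$-orbits and $w$ is constant on each of these orbits. *)

theory Defs
  imports "HOL-Analysis.Analysis" "HOL-Algebra.Group"
begin

text \<open>Real polynomials in \<open>n = CARD('n)\<close> variables are identified with the polynomial functions
  they induce on \<^typ>\<open>real ^ 'n\<close>; this is harmless as the field of reals is infinite.
  The exponents are multi-indices \<open>\<alpha> :: 'n \<Rightarrow> nat\<close>.\<close>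

definition monomial :: "('n::finite \<Rightarrow> nat) \<Rightarrow> real ^ 'n \<Rightarrow> real" where
  "monomial \<alpha> x = (\<Prod>i\<in>UNIV. (x $ i) ^ \<alpha> i)"

definition polys_upto :: "nat \<Rightarrow> (real ^ 'n::finite \<Rightarrow> real) set" where
  "polys_upto t = {f. \<exists>c. f = (\<lambda>x. \<Sum>\<alpha> | sum \<alpha> UNIV \<le> t. c \<alpha> * monomial \<alpha> x)}"

definition homogeneous_polys :: "nat \<Rightarrow> (real ^ 'n::finite \<Rightarrow> real) set" where
  "homogeneous_polys l = {f. \<exists>c. f = (\<lambda>x. \<Sum>\<alpha> | sum \<alpha> UNIV = l. c \<alpha> * monomial \<alpha> x)}"

text \<open>The index sets above are finite, so the sums are genuine.\<close>

lemma finite_multi_indices_le: "finite {\<alpha> :: 'n::finite \<Rightarrow> nat. sum \<alpha> UNIV \<le> t}"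
proof (rule finite_subset)
  show "{\<alpha> :: 'n \<Rightarrow> nat. sum \<alpha> UNIV \<le> t} \<subseteq> (UNIV :: 'n set) \<rightarrow>\<^sub>E {..t}"
  proof
    fix \<alpha> :: "'n \<Rightarrow> nat" assume "\<alpha> \<in> {\<alpha>. sum \<alpha> UNIV \<le> t}"
    moreover have "\<alpha> i \<le> sum \<alpha> UNIV" for i by (rule member_le_sum) simp_all
    ultimately have "\<alpha> i \<le> t" for i using order_trans by blast
    then show "\<alpha> \<in> (UNIV :: 'n set) \<rightarrow>\<^sub>E {..t}" by (simp add: PiE_UNIV_domain)
  qed
  show "finite ((UNIV :: 'n set) \<rightarrow>\<^sub>E {..t})"
    by (intro finite_PiE) auto
qed

lemma finite_multi_indices_eq: "finite {\<alpha> :: 'n::finite \<Rightarrow> nat. sum \<alpha> UNIV = l}"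
  by (rule finite_subset[OF _ finite_multi_indices_le[of l]]) auto

definition partial_deriv :: "'n::finite \<Rightarrow> (real ^ 'n \<Rightarrow> real) \<Rightarrow> real ^ 'n \<Rightarrow> real" where
  "partial_deriv i f x = deriv (\<lambda>s. f (x + s *\<^sub>R axis i 1)) 0"

definition laplacian :: "(real ^ 'n::finite \<Rightarrow> real) \<Rightarrow> real ^ 'n \<Rightarrow> real" where
  "laplacian f x = (\<Sum>i\<in>UNIV. partial_deriv i (partial_deriv i f) x)"

definition Harm :: "nat \<Rightarrow> (real ^ 'n::finite \<Rightarrow> real) set" where
  "Harm l = {f \<in> homogeneous_polys l. \<forall>x. laplacian f x = 0}"

definition orthogonal_group :: "(real ^ 'n::finite \<Rightarrow> real ^ 'n) monoid" where
  "orthogonal_group = \<lparr>carrier = {\<sigma>. orthogonal_transformation \<sigma>}, mult = (\<circ>), one = id\<rparr>"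

lemma group_orthogonal_group: "group (orthogonal_group :: (real ^ 'n::finite \<Rightarrow> real ^ 'n) monoid)"
proof (rule groupI)
  fix \<sigma> :: "real ^ 'n \<Rightarrow> real ^ 'n" assume "\<sigma> \<in> carrier orthogonal_group"
  then have \<sigma>: "orthogonal_transformation \<sigma>" by (simp add: orthogonal_group_def)
  have "inv_into UNIV \<sigma> \<circ> \<sigma> = id"
    using orthogonal_transformation_inj[OF \<sigma>] by simp
  then show "\<exists>\<tau>\<in>carrier orthogonal_group. \<tau> \<otimes>\<^bsub>orthogonal_group\<^esub> \<sigma> = \<one>\<^bsub>orthogonal_group\<^esub>"
    using orthogonal_transformation_inv[OF \<sigma>] by (auto simp: orthogonal_group_def)
qed (auto simp: orthogonal_group_def orthogonal_transformation_compose id_def)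

definition G_orbit :: "('a \<Rightarrow> 'a) set \<Rightarrow> 'a \<Rightarrow> 'a set" where
  "G_orbit G x = {\<sigma> x | \<sigma>. \<sigma> \<in> G}"

definition act :: "('a \<Rightarrow> 'a) \<Rightarrow> ('a \<Rightarrow> 'b) \<Rightarrow> 'a \<Rightarrow> 'b" where
  "act \<sigma> f x = f (inv_into UNIV \<sigma> x)"

definition Harm_inv :: "(real ^ 'n \<Rightarrow> real ^ 'n) set \<Rightarrow> nat \<Rightarrow> (real ^ 'n::finite \<Rightarrow> real) set" where
  "Harm_inv G l = {f \<in> Harm l. \<forall>\<sigma>\<in>G. act \<sigma> f = f}"

text \<open>Surface measure on the sphere of radius \<open>\<rho> > 0\<close> about the origin, as the usual cone measure
  \<open>\<sigma>(A) = (n / \<rho>) \<cdot> \<lambda> {s x | x \<in> A, 0 < s \<le> 1}\<close>, that is, as the image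
  of the scaled Lebesgue measure on the punctured ball under radial projection. The factor
  is fixed by \<open>\<lambda> {s x | x \<in> A, 0 < s \<le> 1} = \<integral>\<^sub>0\<^sup>1 s^(n-1) \<rho> \<sigma>(A) ds\<close>.\<close>

definition sphere_measure :: "real \<Rightarrow> (real ^ 'n::finite) measure" where
  "sphere_measure \<rho> = scale_measure (ennreal (real CARD('n) / \<rho>))
     (distr (restrict_space lborel (cball 0 \<rho> - {0})) (restrict_space borel (sphere 0 \<rho>))
        (\<lambda>x. (\<rho> / norm x) *\<^sub>R x))"

lemma radial_projection_measurable:
  assumes "\<rho> > 0"
  shows "(\<lambda>x :: real ^ 'n::finite. (\<rho> / norm x) *\<^sub>R x)
    \<in> measurable (restrict_space lborel (cball 0 \<rho> - {0})) (restrict_space borel (sphere 0 \<rho>))"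
  using assms by (intro measurable_restrict_space3) auto

lemma emeasure_sphere_measure:
  fixes A :: "(real ^ 'n::finite) set"
  assumes \<rho>: "\<rho> > 0" and A: "A \<in> sets borel" "A \<subseteq> sphere 0 \<rho>"
  shows "emeasure (sphere_measure \<rho>) A =
    ennreal (real CARD('n) / \<rho>) * emeasure lborel {s *\<^sub>R x | s x. x \<in> A \<and> 0 < s \<and> s \<le> 1}"
proof -
  let ?p = "\<lambda>x :: real ^ 'n. (\<rho> / norm x) *\<^sub>R x"
  have "?p -` A \<inter> (cball 0 \<rho> - {0}) = {s *\<^sub>R x | s x. x \<in> A \<and> 0 < s \<and> s \<le> 1}"
  proof (intro equalityI subsetI)
    fix y assume y: "y \<in> ?p -` A \<inter> (cball 0 \<rho> - {0})"
    then have "y = (norm y / \<rho>) *\<^sub>R ?p y" "?p y \<in> A" "0 < norm y / \<rho>" "norm y / \<rho> \<le> 1"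
      using \<rho> by auto
    then show "y \<in> {s *\<^sub>R x | s x. x \<in> A \<and> 0 < s \<and> s \<le> 1}" by blast
  next
    fix y assume "y \<in> {s *\<^sub>R x | s x. x \<in> A \<and> 0 < s \<and> s \<le> 1}"
    then obtain s x where y: "y = s *\<^sub>R x" "x \<in> A" "0 < s" "s \<le> 1" by blast
    then have "norm x = \<rho>" using A by auto
    then show "y \<in> ?p -` A \<inter> (cball 0 \<rho> - {0})"
      using y \<rho> by (auto simp: mult_left_le_one_le)
  qed
  moreover have "{s *\<^sub>R x | s x. x \<in> A \<and> 0 < s \<and> s \<le> 1} \<subseteq> cball 0 \<rho> - {0}"
    using calculation by blast
  moreover have "A \<in> sets (restrict_space borel (sphere 0 \<rho>))"
    using A by (auto simp: sets_restrict_space_iff)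
  ultimately show ?thesis
    using radial_projection_measurable[OF \<rho>, where 'n = 'n]
    by (simp add: sphere_measure_def emeasure_distr emeasure_restrict_space space_restrict_space)
qed

definition sphere_average :: "real \<Rightarrow> (real ^ 'n::finite \<Rightarrow> real) \<Rightarrow> real" where
  "sphere_average \<rho> f =
     (if \<rho> = 0 then f 0
      else 1 / measure (sphere_measure \<rho>) (sphere (0 :: real ^ 'n) \<rho>) *
             (LINT x | sphere_measure \<rho>. f x))"

definition euclidean_design ::
  "nat \<Rightarrow> (real ^ 'n::finite) set \<Rightarrow> (real ^ 'n \<Rightarrow> real) \<Rightarrow> bool" where
  "euclidean_design t X w \<longleftrightarrow>
     finite X \<and> (\<forall>x\<in>X. w x > 0) \<and>
     (\<forall>f\<in>polys_upto t.
        (\<Sum>\<rho>\<in>norm ` X. (\<Sum>x\<in>X \<inter> sphere 0 \<rho>. w x) * sphere_average \<rho> f) = (\<Sum>x\<in>X. w x * f x))"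

definition const_on_orbits :: "('a \<Rightarrow> 'a) set \<Rightarrow> 'a set \<Rightarrow> ('a \<Rightarrow> real) \<Rightarrow> bool" where
  "const_on_orbits G X w \<longleftrightarrow> (\<forall>x. G_orbit G x \<subseteq> X \<longrightarrow> w constant_on G_orbit G x)"

definition invariant_euclidean_design ::
  "(real ^ 'n \<Rightarrow> real ^ 'n) set \<Rightarrow> nat \<Rightarrow> (real ^ 'n::finite) set \<Rightarrow> (real ^ 'n \<Rightarrow> real) \<Rightarrow> bool" where
  "invariant_euclidean_design G t X w \<longleftrightarrow>
     euclidean_design t X w \<and> (\<exists>Y. X = (\<Union>y\<in>Y. G_orbit G y)) \<and> const_on_orbits G X w"

end

(* Write Delta for the Laplacian. For h harmonic and homogeneous, Delta(|x|^(2j+2) h) is a positive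
   multiple of |x|^(2j) h, so by induction on the degree every polynomial of degree at most t is a
   sum of terms |x|^(2j) h with h harmonic of some degree l and l + 2j <= t. For l = 0 the design
   equation holds trivially. For l >= 1 the spherical means of h vanish: rotation invariance of the
   sphere makes the integral of every rotation field x_i d_j f - x_j d_i f vanish, and summing these
   with f = x_i d_j h over all i, j gives -l (l + n - 2) h; the exceptional case l = n = 1 is oddness.
   So the design property says that the sums over X of w |x|^(2j) h vanish for all harmonic h, and by
   invariance of X and w such a sum is unchanged if h is replaced by its average over G. *)
theory Submission
  imports Defs
begin

section \<open>Homogeneous polynomials and partial derivatives\<close>

text \<open>The double sum in the overview is not ad hoc: by antisymmetry in i and j it equals
  sum_{i<j} (x_i d_j - x_j d_i)^2 h, the spherical Laplacian of h, and -l (l + n - 2) is its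
  eigenvalue on harmonics of degree l. The fields x_i d_j - x_j d_i are the velocity fields of the
  plane rotations, so differentiating the rotation invariance of the integral at angle 0 takes the
  place of an integration by parts. Since the surface measure is defined by Lebesgue measure on
  cones, its invariance is traced back to that of Lebesgue measure. Polynomials are functions here;
  an induction principle (zero, constants, sums, multiplication by a coordinate) hides the
  multi-indices in most arguments on degrees and derivatives. On each sphere |x|^(2j) is the
  constant rho^(2j), and all radii are positive, so that vanishing means of h settle |x|^(2j) h as
  well.\<close>

lemma homogeneous_polys_zero: "(\<lambda>x. 0) \<in> homogeneous_polys l"
  unfolding homogeneous_polys_def by (auto intro!: exI[of _ "\<lambda>_. 0"])

lemma homogeneous_polys_add:
  assumes "f \<in> homogeneous_polys l" "g \<in> homogeneous_polys l"
  shows "(\<lambda>x. f x + g x) \<in> homogeneous_polys l"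
proof -
  obtain c d where "f = (\<lambda>x. \<Sum>\<alpha> | sum \<alpha> UNIV = l. c \<alpha> * monomial \<alpha> x)"
    "g = (\<lambda>x. \<Sum>\<alpha> | sum \<alpha> UNIV = l. d \<alpha> * monomial \<alpha> x)"
    using assms unfolding homogeneous_polys_def by blast
  then show ?thesis
    unfolding homogeneous_polys_def
    by (auto intro!: exI[of _ "\<lambda>\<alpha>. c \<alpha> + d \<alpha>"] simp: sum.distrib distrib_right)
qed

lemma homogeneous_polys_scale:
  assumes "f \<in> homogeneous_polys l"
  shows "(\<lambda>x. c * f x) \<in> homogeneous_polys l"
proof -
  obtain d where "f = (\<lambda>x. \<Sum>\<alpha> | sum \<alpha> UNIV = l. d \<alpha> * monomial \<alpha> x)"
    using assms unfolding homogeneous_polys_def by blast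
  then show ?thesis
    unfolding homogeneous_polys_def
    by (auto intro!: exI[of _ "\<lambda>\<alpha>. c * d \<alpha>"] simp: sum_distrib_left mult.assoc)
qed

lemma homogeneous_polys_sum:
  assumes "\<And>i. i \<in> I \<Longrightarrow> f i \<in> homogeneous_polys l"
  shows "(\<lambda>x. \<Sum>i\<in>I. f i x) \<in> homogeneous_polys l"
  using assms
  by (induction I rule: infinite_finite_induct)
    (auto intro: homogeneous_polys_zero homogeneous_polys_add)

lemma homogeneous_polys_monomial:
  "(\<lambda>x. c * monomial \<alpha> x) \<in> homogeneous_polys (sum \<alpha> UNIV)"
proof -
  have "(\<Sum>\<beta> | sum \<beta> UNIV = sum \<alpha> UNIV. (if \<beta> = \<alpha> then c else 0) * monomial \<beta> x) = c * monomial \<alpha> x"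
    for x by (simp add: if_distrib[of "\<lambda>u. u * _"] finite_multi_indices_eq cong: if_cong)
  then show ?thesis
    unfolding homogeneous_polys_def
    by (auto intro!: exI[of _ "\<lambda>\<beta>. if \<beta> = \<alpha> then c else 0"])
qed

lemma homogeneous_polys_const: "(\<lambda>x. c) \<in> homogeneous_polys 0"
  using homogeneous_polys_monomial[of c "\<lambda>_. 0"] by (simp add: monomial_def)

lemma monomial_upd: "monomial (\<alpha>(i := Suc (\<alpha> i))) x = x $ i * monomial \<alpha> x"
proof -
  have "monomial (\<alpha>(i := Suc (\<alpha> i))) x
      = x $ i ^ Suc (\<alpha> i) * (\<Prod>k\<in>UNIV - {i}. x $ k ^ (\<alpha>(i := Suc (\<alpha> i))) k)"
    unfolding monomial_def by (subst prod.remove[of UNIV i]) auto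
  also have "(\<Prod>k\<in>UNIV - {i}. x $ k ^ (\<alpha>(i := Suc (\<alpha> i))) k) = (\<Prod>k\<in>UNIV - {i}. x $ k ^ \<alpha> k)"
    by (rule prod.cong) auto
  also have "x $ i ^ Suc (\<alpha> i) * \<dots> = x $ i * monomial \<alpha> x"
    unfolding monomial_def by (simp add: prod.remove[of UNIV i "\<lambda>k. x $ k ^ \<alpha> k"])
  finally show ?thesis .
qed

lemma sum_upd_Suc: "sum (\<alpha>(i := Suc (\<alpha> i))) UNIV = Suc (sum \<alpha> (UNIV :: 'n::finite set))"
proof -
  have "sum (\<alpha>(i := Suc (\<alpha> i))) UNIV = Suc (\<alpha> i) + sum (\<alpha>(i := Suc (\<alpha> i))) (UNIV - {i})"
    by (subst sum.remove[of UNIV i]) auto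
  also have "sum (\<alpha>(i := Suc (\<alpha> i))) (UNIV - {i}) = sum \<alpha> (UNIV - {i})"
    by (rule sum.cong) auto
  finally show ?thesis by (simp add: sum.remove[of UNIV i \<alpha>])
qed

lemma homogeneous_polys_coord_mult:
  assumes "f \<in> homogeneous_polys l"
  shows "(\<lambda>x. x $ i * f x) \<in> homogeneous_polys (Suc l)"
proof -
  obtain c where f: "f = (\<lambda>x. \<Sum>\<alpha> | sum \<alpha> UNIV = l. c \<alpha> * monomial \<alpha> x)"
    using assms unfolding homogeneous_polys_def by blast
  have "(\<lambda>x. \<Sum>\<alpha> | sum \<alpha> UNIV = l. c \<alpha> * monomial (\<alpha>(i := Suc (\<alpha> i))) x) \<in> homogeneous_polys (Suc l)"
    using homogeneous_polys_monomial[where \<alpha> = "\<alpha>(i := Suc (\<alpha> i))" for \<alpha>]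
    by (intro homogeneous_polys_sum) (metis (mono_tags) mem_Collect_eq sum_upd_Suc)
  moreover have "(\<lambda>x. x $ i * f x)
      = (\<lambda>x. \<Sum>\<alpha> | sum \<alpha> UNIV = l. c \<alpha> * monomial (\<alpha>(i := Suc (\<alpha> i))) x)"
    unfolding f monomial_upd by (simp add: sum_distrib_left mult.left_commute)
  ultimately show ?thesis by simp
qed

text \<open>A monomial of positive degree is a coordinate times a monomial of degree one less. The
  scalar is carried along with the monomial, so \<open>P\<close> is only asked to respect sums and
  coordinate factors; \<open>P\<close> depends on the degree because the \<open>coord\<close> step
  raises it.\<close>

lemma homogeneous_polys_induct [consumes 1, case_names zero const add coord]:
  fixes f :: "real ^ 'n::finite \<Rightarrow> real"
  assumes "f \<in> homogeneous_polys l"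
    and zero: "\<And>l. P l (\<lambda>x. 0)"
    and const: "\<And>c. P 0 (\<lambda>x. c)"
    and add: "\<And>l f g. f \<in> homogeneous_polys l \<Longrightarrow> g \<in> homogeneous_polys l \<Longrightarrow>
      P l f \<Longrightarrow> P l g \<Longrightarrow> P l (\<lambda>x. f x + g x)"
    and coord: "\<And>l f i. f \<in> homogeneous_polys l \<Longrightarrow> P l f \<Longrightarrow> P (Suc l) (\<lambda>x. x $ i * f x)"
  shows "P l f"
proof -
  have mono: "P (sum \<alpha> UNIV) (\<lambda>x. c * monomial \<alpha> x)" for \<alpha> :: "'n \<Rightarrow> nat" and c
  proof (induction "sum \<alpha> UNIV" arbitrary: \<alpha>)
    case 0
    then have "\<alpha> = (\<lambda>_. 0)" by auto
    then show ?case using const[of c] by (simp add: monomial_def)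
  next
    case (Suc l)
    then obtain i where "\<alpha> i \<noteq> 0" by (metis sum.neutral nat.distinct(1))
    define \<beta> where "\<beta> = \<alpha>(i := \<alpha> i - 1)"
    have \<alpha>: "\<alpha> = \<beta>(i := Suc (\<beta> i))" using \<open>\<alpha> i \<noteq> 0\<close> by (auto simp: \<beta>_def)
    then have "l = sum \<beta> UNIV" using Suc(2) sum_upd_Suc[of \<beta> i] by simp
    then have "P (Suc (sum \<beta> UNIV)) (\<lambda>x. x $ i * (c * monomial \<beta> x))"
      using Suc(1)[of \<beta>] by (intro coord homogeneous_polys_monomial) auto
    then show ?case
      unfolding \<alpha> sum_upd_Suc monomial_upd by (simp add: mult.left_commute)
  qed
  obtain c where f: "f = (\<lambda>x. \<Sum>\<alpha> | sum \<alpha> UNIV = l. c \<alpha> * monomial \<alpha> x)"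
    using assms(1) unfolding homogeneous_polys_def by blast
  \<comment> \<open>The index set is generalised to subsets so that set induction applies; every
    partial sum stays homogeneous of the same degree \<open>l\<close>, as \<open>add\<close>
    demands.\<close>
  have "P l (\<lambda>x. \<Sum>\<alpha>\<in>A. c \<alpha> * monomial \<alpha> x)"
    if "A \<subseteq> {\<alpha>. sum \<alpha> UNIV = l}" for A
  proof -
    have "finite A" using that finite_multi_indices_eq finite_subset by blast
    then show ?thesis using that
    proof (induction A)
      case empty
      then show ?case using zero by simp
    next
      case (insert \<alpha> A)
      then have l: "sum \<beta> UNIV = l" if "\<beta> \<in> insert \<alpha> A" for \<beta> using that by blast
      have "P l (\<lambda>x. c \<alpha> * monomial \<alpha> x + (\<Sum>\<alpha>\<in>A. c \<alpha> * monomial \<alpha> x))"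
      proof (intro add homogeneous_polys_sum)
        show "(\<lambda>x. c \<beta> * monomial \<beta> x) \<in> homogeneous_polys l" if "\<beta> \<in> A" for \<beta>
          using homogeneous_polys_monomial[of "c \<beta>" \<beta>] l[of \<beta>] that by simp
        show "(\<lambda>x. c \<alpha> * monomial \<alpha> x) \<in> homogeneous_polys l"
          using homogeneous_polys_monomial[of "c \<alpha>" \<alpha>] l[of \<alpha>] by simp
        show "P l (\<lambda>x. c \<alpha> * monomial \<alpha> x)"
          using mono[of \<alpha> "c \<alpha>"] l[of \<alpha>] by simp
        show "P l (\<lambda>x. \<Sum>\<alpha>\<in>A. c \<alpha> * monomial \<alpha> x)"
          using insert by simp
      qed
      then show ?case using insert by simp
    qed
  qed
  then show ?thesis unfolding f by simp
qed

lemma homogeneous_polys_mult: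
  assumes "f \<in> homogeneous_polys k" "g \<in> homogeneous_polys l"
  shows "(\<lambda>x. f x * g x) \<in> homogeneous_polys (k + l)"
  using assms(1)
proof (induction rule: homogeneous_polys_induct)
  case (add l f1 f2)
  then show ?case using homogeneous_polys_add[OF add(3,4)] by (simp add: distrib_right)
next
  case (coord l f i)
  then show ?case using homogeneous_polys_coord_mult[OF coord(2), of i] by (simp add: mult.assoc)
qed (use assms(2) in \<open>auto intro: homogeneous_polys_zero homogeneous_polys_scale\<close>)

lemma homogeneous_polys_coord: "(\<lambda>x. x $ i) \<in> homogeneous_polys 1"
  using homogeneous_polys_coord_mult[OF homogeneous_polys_const[of 1], of i] by simp

lemma homogeneous_polys_norm_power:
  "(\<lambda>x :: real ^ 'n::finite. norm x ^ (2 * j)) \<in> homogeneous_polys (2 * j)"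
proof (induction j)
  case 0
  then show ?case using homogeneous_polys_const[of 1] by simp
next
  case (Suc j)
  have "(\<lambda>x :: real ^ 'n. \<Sum>i\<in>UNIV. x $ i * x $ i) \<in> homogeneous_polys (Suc 1)"
    by (intro homogeneous_polys_sum homogeneous_polys_coord_mult homogeneous_polys_coord)
  moreover have "(\<Sum>i\<in>UNIV. x $ i * x $ i) = norm x ^ 2" for x :: "real ^ 'n"
    by (simp add: power2_norm_eq_inner inner_vec_def)
  ultimately have "(\<lambda>x :: real ^ 'n. norm x ^ 2 * norm x ^ (2 * j)) \<in> homogeneous_polys (Suc 1 + 2 * j)"
    by (intro homogeneous_polys_mult Suc) simp
  then show ?case by (simp add: power_add power2_eq_square mult.assoc)
qed

text \<open>In the coordinate step \<open>x $ i\<close> becomes the linear form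
  \<open>R x $ i\<close>, a combination of coordinates, so the degree again rises by exactly
  one.\<close>

lemma homogeneous_polys_compose_linear:
  fixes f :: "real ^ 'n::finite \<Rightarrow> real"
  assumes "f \<in> homogeneous_polys l" and R: "linear (R :: real ^ 'n \<Rightarrow> real ^ 'n)"
  shows "(\<lambda>x. f (R x)) \<in> homogeneous_polys l"
  using assms(1)
proof (induction rule: homogeneous_polys_induct)
  case (coord l f i)
  have R_expand: "R x $ i = (\<Sum>k\<in>UNIV. x $ k * R (axis k 1) $ i)" for x
  proof -
    have "R x = R (\<Sum>k\<in>UNIV. x $ k *\<^sub>R axis k 1)"
      using basis_expansion[of x] by (simp add: scalar_mult_eq_scaleR)
    then show ?thesis by (simp add: linear_sum[OF R] linear_scale[OF R])
  qed
  have "(\<lambda>x. R x $ i * f (R x)) = (\<lambda>x. \<Sum>k\<in>UNIV. R (axis k 1) $ i * (x $ k * f (R x)))"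
    by (subst R_expand) (simp add: sum_distrib_left sum_distrib_right mult_ac)
  moreover have "\<dots> \<in> homogeneous_polys (Suc l)"
    by (intro homogeneous_polys_sum homogeneous_polys_scale homogeneous_polys_coord_mult coord(2))
  ultimately show ?case by simp
qed (auto intro: homogeneous_polys_zero homogeneous_polys_const homogeneous_polys_add)

lemma homogeneous_polys_scaleR:
  assumes "f \<in> homogeneous_polys l"
  shows "f (c *\<^sub>R x) = c ^ l * f x"
  using assms by (induction rule: homogeneous_polys_induct) (auto simp: distrib_left)

section \<open>Partial derivatives and Euler's identity\<close>

lemma homogeneous_polys_differentiable:
  assumes "f \<in> homogeneous_polys l"
  shows "f differentiable (at x)"
  using assms
proof (induction rule: homogeneous_polys_induct)
  case (coord l f i)
  have "(\<lambda>x. x $ i) differentiable (at x)"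
    by (intro bounded_linear_imp_differentiable bounded_linear_vec_nth)
  then show ?case using coord by simp
qed auto

lemma homogeneous_polys_continuous_on:
  "f \<in> homogeneous_polys l \<Longrightarrow> continuous_on S f"
  using homogeneous_polys_differentiable
  by (intro continuous_at_imp_continuous_on ballI differentiable_imp_continuous_within) blast

text \<open>The line \<open>x + s *\<^sub>R axis i 1\<close> is composed with the Frechet derivative
  of \<open>f\<close>. This link lets \<open>partial_deriv\<close> inherit the sum, product and
  chain rules from \<open>has_derivative\<close>.\<close>

lemma partial_deriv_frechet:
  assumes "f differentiable (at x)"
  shows "partial_deriv i f x = frechet_derivative f (at x) (axis i 1)"
proof -
  have "((\<lambda>s. x + s *\<^sub>R axis i 1) has_derivative (\<lambda>s. s *\<^sub>R axis i 1)) (at 0)"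
    by (auto intro!: derivative_eq_intros)
  moreover have f: "(f has_derivative frechet_derivative f (at x)) (at (x + 0 *\<^sub>R axis i 1))"
    using assms by (simp add: frechet_derivative_works)
  ultimately have "((\<lambda>s. f (x + s *\<^sub>R axis i 1)) has_derivative
      (\<lambda>s. frechet_derivative f (at x) (s *\<^sub>R axis i 1))) (at 0)"
    by (rule has_derivative_compose)
  moreover have "frechet_derivative f (at x) (s *\<^sub>R axis i 1)
      = frechet_derivative f (at x) (axis i 1) * s" for s
    using linear_frechet_derivative[OF assms] by (simp add: linear_scale)
  ultimately show ?thesis
    unfolding partial_deriv_def has_field_derivative_def[symmetric]
    by (auto intro!: DERIV_imp_deriv simp: has_field_derivative_def)
qed

lemma has_derivative_partial_deriv:
  assumes "f differentiable (at x)"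
  shows "(f has_derivative (\<lambda>h. \<Sum>i\<in>UNIV. h $ i * partial_deriv i f x)) (at x)"
proof -
  interpret linear "frechet_derivative f (at x)" by (rule linear_frechet_derivative[OF assms])
  have "frechet_derivative f (at x) h = (\<Sum>i\<in>UNIV. h $ i * partial_deriv i f x)" for h
  proof -
    have "frechet_derivative f (at x) h = frechet_derivative f (at x) (\<Sum>i\<in>UNIV. h $ i *\<^sub>R axis i 1)"
      using basis_expansion[of h] by (simp add: scalar_mult_eq_scaleR)
    then show ?thesis by (simp add: partial_deriv_frechet[OF assms] sum scale)
  qed
  then have "frechet_derivative f (at x) = (\<lambda>h. \<Sum>i\<in>UNIV. h $ i * partial_deriv i f x)"
    by (rule ext)
  then show ?thesis using assms by (simp add: frechet_derivative_works)
qed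

lemma partial_deriv_eqI:
  assumes "(f has_derivative f') (at x)"
  shows "partial_deriv i f x = f' (axis i 1)"
  using assms by (metis differentiable_def frechet_derivative_at partial_deriv_frechet)

lemma partial_deriv_const: "partial_deriv i (\<lambda>x. c) x = 0"
  by (simp add: partial_deriv_def)

lemma partial_deriv_coord:
  "partial_deriv i (\<lambda>x. x $ k) x = (if i = k then 1 else 0)"
  by (subst partial_deriv_eqI[OF bounded_linear.has_derivative[OF bounded_linear_vec_nth has_derivative_ident]])
    (auto simp: axis_def)

lemma partial_deriv_add:
  assumes "f differentiable (at x)" "g differentiable (at x)"
  shows "partial_deriv i (\<lambda>x. f x + g x) x = partial_deriv i f x + partial_deriv i g x"
  using assms by (subst partial_deriv_eqI[OF has_derivative_add]) 
    (auto simp: frechet_derivative_works partial_deriv_frechet)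

lemma partial_deriv_mult:
  assumes "f differentiable (at x)" "g differentiable (at x)"
  shows "partial_deriv i (\<lambda>x. f x * g x) x = partial_deriv i f x * g x + f x * partial_deriv i g x"
  using assms by (subst partial_deriv_eqI[OF has_derivative_mult])
    (auto simp: frechet_derivative_works partial_deriv_frechet)

lemma partial_deriv_scale:
  assumes "f differentiable (at x)"
  shows "partial_deriv i (\<lambda>x. c * f x) x = c * partial_deriv i f x"
  using assms partial_deriv_mult[of "\<lambda>x. c" x f i] by (simp add: partial_deriv_const)

lemma partial_deriv_sum:
  assumes "finite I" "\<And>k. k \<in> I \<Longrightarrow> f k differentiable (at x)"
  shows "partial_deriv i (\<lambda>x. \<Sum>k\<in>I. f k x) x = (\<Sum>k\<in>I. partial_deriv i (f k) x)"
  using assms by (induction I) (auto simp: partial_deriv_const partial_deriv_add)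

text \<open>The second conjunct repairs the truncated \<open>l - 1\<close>: for a constant
  \<open>f\<close>, the product \<open>x $ k * partial_deriv i f x\<close> in the coordinate step
  must have degree 0 rather than 1, which holds because the derivative vanishes.\<close>

lemma homogeneous_polys_partial_deriv:
  assumes "f \<in> homogeneous_polys l"
  shows "partial_deriv i f \<in> homogeneous_polys (l - 1) \<and> (l = 0 \<longrightarrow> partial_deriv i f = (\<lambda>x. 0))"
  using assms
proof (induction rule: homogeneous_polys_induct)
  case (add l f g)
  then have "partial_deriv i (\<lambda>x. f x + g x) = (\<lambda>x. partial_deriv i f x + partial_deriv i g x)"
    by (auto simp: partial_deriv_add homogeneous_polys_differentiable)
  then show ?case using add by (auto intro: homogeneous_polys_add)
next
  case (coord l f k)
  have "partial_deriv i (\<lambda>x. x $ k * f x) x = (if i = k then 1 else 0) * f x + x $ k * partial_deriv i f x"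
    for x
    by (subst partial_deriv_mult)
      (auto simp: partial_deriv_coord homogeneous_polys_differentiable[OF coord(1)]
        homogeneous_polys_differentiable[OF homogeneous_polys_coord])
  moreover have "(\<lambda>x. x $ k * partial_deriv i f x) \<in> homogeneous_polys l"
    using coord(2) homogeneous_polys_coord_mult[of "partial_deriv i f" "l - 1" k]
    by (cases l) (auto simp: homogeneous_polys_zero)
  ultimately show ?case
    using homogeneous_polys_add[OF homogeneous_polys_scale[OF coord(1), of "if i = k then 1 else 0"]]
    by (auto simp: fun_eq_iff)
qed (auto simp: partial_deriv_const[abs_def] intro: homogeneous_polys_zero)

lemma homogeneous_polys_euler:
  assumes "f \<in> homogeneous_polys l"
  shows "(\<Sum>i\<in>UNIV. x $ i * partial_deriv i f x) = real l * f x"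
  using assms
proof (induction rule: homogeneous_polys_induct)
  case (add l f g)
  then show ?case
    by (simp add: partial_deriv_add homogeneous_polys_differentiable distrib_left sum.distrib)
next
  case (coord l f k)
  have "(\<Sum>i\<in>UNIV. x $ i * partial_deriv i (\<lambda>x. x $ k * f x) x)
      = (\<Sum>i\<in>UNIV. (if i = k then x $ k * f x else 0) + x $ k * (x $ i * partial_deriv i f x))"
    by (intro sum.cong refl, subst partial_deriv_mult)
      (auto simp: partial_deriv_coord algebra_simps homogeneous_polys_differentiable[OF coord(1)]
        homogeneous_polys_differentiable[OF homogeneous_polys_coord])
  also have "\<dots> = real (Suc l) * (x $ k * f x)"
    by (simp add: sum.distrib sum_distrib_left[symmetric] coord(2)) (simp add: algebra_simps)
  finally show ?case .
qed (auto simp: partial_deriv_const)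

section \<open>Harmonic decomposition\<close>

lemma homogeneous_polys_partial_deriv_differentiable:
  "f \<in> homogeneous_polys l \<Longrightarrow> partial_deriv i f differentiable (at x)"
  using homogeneous_polys_partial_deriv homogeneous_polys_differentiable by blast

lemma homogeneous_polys_laplacian:
  assumes "f \<in> homogeneous_polys l"
  shows "laplacian f \<in> homogeneous_polys (l - 2)"
    and "l < 2 \<Longrightarrow> laplacian f = (\<lambda>x. 0)"
proof -
  have D: "partial_deriv i f \<in> homogeneous_polys (l - 1)" for i
    using homogeneous_polys_partial_deriv[OF assms] by blast
  have "(\<lambda>x. \<Sum>i\<in>UNIV. partial_deriv i (partial_deriv i f) x) \<in> homogeneous_polys (l - 1 - 1)"
    using homogeneous_polys_partial_deriv[OF D] by (intro homogeneous_polys_sum) blast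
  moreover have "laplacian f = (\<lambda>x. \<Sum>i\<in>UNIV. partial_deriv i (partial_deriv i f) x)"
    by (rule ext) (rule laplacian_def)
  moreover have "l - 1 - 1 = l - 2" by simp
  ultimately show "laplacian f \<in> homogeneous_polys (l - 2)" by metis
  show "laplacian f = (\<lambda>x. 0)" if "l < 2"
  proof -
    have "partial_deriv i (partial_deriv i f) = (\<lambda>x. 0)" for i
      using homogeneous_polys_partial_deriv[OF D[of i], of i] that by simp
    then show ?thesis by (auto simp: laplacian_def)
  qed
qed

lemma laplacian_add:
  assumes "f \<in> homogeneous_polys k" "g \<in> homogeneous_polys l"
  shows "laplacian (\<lambda>x. f x + g x) x = laplacian f x + laplacian g x"
proof -
  have "partial_deriv i (\<lambda>x. f x + g x) = (\<lambda>x. partial_deriv i f x + partial_deriv i g x)" for i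
    using assms by (auto simp: partial_deriv_add homogeneous_polys_differentiable)
  then show ?thesis
    using assms
    by (simp add: laplacian_def partial_deriv_add homogeneous_polys_partial_deriv_differentiable sum.distrib)
qed

lemma laplacian_scale:
  assumes "f \<in> homogeneous_polys l"
  shows "laplacian (\<lambda>x. c * f x) x = c * laplacian f x"
proof -
  have "partial_deriv i (\<lambda>x. c * f x) = (\<lambda>x. c * partial_deriv i f x)" for i
    using assms by (auto simp: partial_deriv_scale homogeneous_polys_differentiable)
  then show ?thesis
    using assms
    by (simp add: laplacian_def partial_deriv_scale homogeneous_polys_partial_deriv_differentiable
        sum_distrib_left)
qed

lemma laplacian_sum:
  assumes "finite I" "\<And>k. k \<in> I \<Longrightarrow> f k \<in> homogeneous_polys l"
  shows "laplacian (\<lambda>x. \<Sum>k\<in>I. f k x) x = (\<Sum>k\<in>I. laplacian (f k) x)"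
  using assms
proof (induction I)
  case empty
  then show ?case by (simp add: homogeneous_polys_laplacian(2)[OF homogeneous_polys_zero, of 0])
next
  case (insert k I)
  then show ?case
    using laplacian_add[OF insert(4)[of k] homogeneous_polys_sum[of I f l]] by simp
qed

lemma laplacian_mult:
  assumes f: "f \<in> homogeneous_polys k" and g: "g \<in> homogeneous_polys l"
  shows "laplacian (\<lambda>x. f x * g x) x
    = laplacian f x * g x + 2 * (\<Sum>i\<in>UNIV. partial_deriv i f x * partial_deriv i g x) + f x * laplacian g x"
proof -
  have D: "partial_deriv i (\<lambda>x. f x * g x) = (\<lambda>x. partial_deriv i f x * g x + f x * partial_deriv i g x)" for i
    using assms by (auto simp: partial_deriv_mult homogeneous_polys_differentiable)
  note diff = homogeneous_polys_differentiable[OF f] homogeneous_polys_differentiable[OF g]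
    homogeneous_polys_partial_deriv_differentiable[OF f] homogeneous_polys_partial_deriv_differentiable[OF g]
  have "partial_deriv i (partial_deriv i (\<lambda>x. f x * g x)) x
      = partial_deriv i (partial_deriv i f) x * g x + 2 * (partial_deriv i f x * partial_deriv i g x)
        + f x * partial_deriv i (partial_deriv i g) x" for i
    unfolding D by (simp add: partial_deriv_add partial_deriv_mult diff)
  then show ?thesis
    by (simp add: laplacian_def sum.distrib sum_distrib_left sum_distrib_right)
qed

lemma norm_square_eq_sum: "norm x ^ 2 = (\<Sum>k\<in>UNIV. x $ k * x $ k)" for x :: "real ^ 'n::finite"
  by (simp add: power2_norm_eq_inner inner_vec_def)

lemma norm_square_homogeneous: "(\<lambda>x. norm x ^ 2) \<in> homogeneous_polys 2"
  using homogeneous_polys_norm_power[of 1] by simp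

lemma partial_deriv_norm_square:
  "partial_deriv i (\<lambda>x. norm x ^ 2) x = 2 * x $ i"
proof -
  note diff = homogeneous_polys_differentiable[OF homogeneous_polys_coord]
  have "partial_deriv i (\<lambda>x. x $ k * x $ k) x = (if k = i then 2 * x $ i else 0)" for k
    by (subst partial_deriv_mult) (auto simp: diff partial_deriv_coord)
  then show ?thesis
    unfolding norm_square_eq_sum by (subst partial_deriv_sum) (auto simp: diff)
qed

lemma laplacian_norm_square:
  "laplacian (\<lambda>x. norm x ^ 2) x = 2 * real CARD('n)" for x :: "real ^ 'n::finite"
proof -
  have "partial_deriv i (\<lambda>x :: real ^ 'n. norm x ^ 2) = (\<lambda>x. 2 * x $ i)" for i
    by (rule ext) (rule partial_deriv_norm_square)
  then show ?thesis
    by (simp add: laplacian_def partial_deriv_scale partial_deriv_coord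
        homogeneous_polys_differentiable[OF homogeneous_polys_coord])
qed

text \<open>The cross term of the product rule is 4 times the sum of
  \<open>x $ i * partial_deriv i f x\<close>, which Euler's identity turns into 4 l f; the Laplacian
  of |x|^2 contributes 2n.\<close>

lemma laplacian_norm_square_mult:
  fixes f :: "real ^ 'n::finite \<Rightarrow> real"
  assumes f: "f \<in> homogeneous_polys l"
  shows "laplacian (\<lambda>x. norm x ^ 2 * f x) x = (2 * real CARD('n) + 4 * real l) * f x + norm x ^ 2 * laplacian f x"
proof -
  have "(\<Sum>i\<in>UNIV. partial_deriv i (\<lambda>x. norm x ^ 2) x * partial_deriv i f x) = 2 * (real l * f x)"
    unfolding partial_deriv_norm_square homogeneous_polys_euler[OF f, symmetric]
    by (simp add: sum_distrib_left mult.assoc)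
  then show ?thesis
    by (simp only: laplacian_mult[OF norm_square_homogeneous f] laplacian_norm_square)
      (simp add: algebra_simps)
qed

text \<open>Each further factor |x|^2 adds \<open>2n + 4 deg\<close> to the constant, with the
  degree of the polynomial being multiplied. The constant stays existential because later only its
  positivity matters, for dividing by it.\<close>

lemma laplacian_norm_power_mult_harmonic:
  fixes h :: "real ^ 'n::finite \<Rightarrow> real"
  assumes h: "h \<in> Harm l"
  shows "\<exists>d>0. \<forall>x. laplacian (\<lambda>x. norm x ^ (2 * Suc j) * h x) x = d * (norm x ^ (2 * j) * h x)"
proof (induction j)
  case 0
  have "laplacian (\<lambda>x. norm x ^ 2 * h x) x = (2 * real CARD('n) + 4 * real l) * h x" for x
    using h by (subst laplacian_norm_square_mult) (auto simp: Harm_def)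
  then show ?case
    by (intro exI[of _ "2 * real CARD('n) + 4 * real l"]) (auto intro!: add_pos_nonneg)
next
  case (Suc j)
  then obtain d where d: "d > 0"
    "\<And>x. laplacian (\<lambda>x. norm x ^ (2 * Suc j) * h x) x = d * (norm x ^ (2 * j) * h x)" by blast
  let ?c = "2 * real CARD('n) + 4 * real (2 * Suc j + l) + d"
  have H: "(\<lambda>x. norm x ^ (2 * Suc j) * h x) \<in> homogeneous_polys (2 * Suc j + l)"
    using h by (intro homogeneous_polys_mult homogeneous_polys_norm_power) (auto simp: Harm_def)
  have split: "norm x ^ (2 * Suc k) * y = norm x ^ 2 * (norm x ^ (2 * k) * y)" for x :: "real ^ 'n" and y k
    by (simp add: power_add power2_eq_square mult.assoc)
  have "laplacian (\<lambda>x. norm x ^ (2 * Suc (Suc j)) * h x) x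
      = laplacian (\<lambda>x. norm x ^ 2 * (norm x ^ (2 * Suc j) * h x)) x" for x
    by (simp only: split[of _ "Suc j"])
  also have "\<dots> x = ?c * (norm x ^ (2 * Suc j) * h x)" for x
    by (subst laplacian_norm_square_mult[OF H], subst d(2)) (simp only: split[of x j], algebra)
  finally show ?case
    using d(1) by (intro exI[of _ ?c]) (auto intro!: add_pos_pos add_nonneg_pos)
qed

text \<open>If \<open>\<Delta> f = \<Sum>j. |x|\<^bsup>2j\<^esup> h\<^sub>j\<close>, then \<open>f - \<Sum>j. |x|\<^bsup>2(j+1)\<^esup> h\<^sub>j / d\<^sub>j\<close> is harmonic
  for the constants \<open>d\<^sub>j\<close> of the previous lemma.\<close>

lemma homogeneous_polys_harmonic_decomposition:
  fixes f :: "real ^ 'n::finite \<Rightarrow> real"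
  assumes "f \<in> homogeneous_polys l"
  shows "\<exists>h. (\<forall>j \<le> l div 2. h j \<in> Harm (l - 2 * j)) \<and> f = (\<lambda>x. \<Sum>j\<le>l div 2. norm x ^ (2 * j) * h j x)"
  using assms
proof (induction l arbitrary: f rule: less_induct)
  case (less l)
  show ?case
  proof (cases "l < 2")
    case True
    then have "f \<in> Harm l"
      using less(2) homogeneous_polys_laplacian(2)[OF less(2)] by (simp add: Harm_def)
    then show ?thesis using True by (intro exI[of _ "\<lambda>_. f"]) simp
  next
    case False
    then obtain m where l: "l = Suc (Suc m)" by (metis add_2_eq_Suc le_Suc_ex not_less)
    obtain h where h: "\<And>j. j \<le> m div 2 \<Longrightarrow> h j \<in> Harm (m - 2 * j)"
      and f: "laplacian f = (\<lambda>x. \<Sum>j\<le>m div 2. norm x ^ (2 * j) * h j x)"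
      using less(1)[of m "laplacian f"] homogeneous_polys_laplacian(1)[OF less(2)] l by auto
    \<comment> \<open>The bound on \<open>j\<close> sits inside the existential, so that a constant
      exists for every \<open>j\<close> and a function \<open>d\<close> can be chosen.\<close>
    have "\<exists>d. j \<le> m div 2 \<longrightarrow> d > 0 \<and>
        (\<forall>x. laplacian (\<lambda>x. norm x ^ (2 * Suc j) * h j x) x = d * (norm x ^ (2 * j) * h j x))" for j
      using laplacian_norm_power_mult_harmonic[OF h, of j j] by blast
    then obtain d where d_harm: "\<And>j. j \<le> m div 2 \<Longrightarrow> d j > 0 \<and>
        (\<forall>x. laplacian (\<lambda>x. norm x ^ (2 * Suc j) * h j x) x = d j * (norm x ^ (2 * j) * h j x))"
      by moura
    then have d: "\<And>j. j \<le> m div 2 \<Longrightarrow> d j > 0"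
      "\<And>j x. j \<le> m div 2 \<Longrightarrow>
        laplacian (\<lambda>x. norm x ^ (2 * Suc j) * h j x) x = d j * (norm x ^ (2 * j) * h j x)"
      by blast+
    define g where "g = (\<lambda>x. \<Sum>j\<le>m div 2. - inverse (d j) * (norm x ^ (2 * Suc j) * h j x))"
    have H: "(\<lambda>x. norm x ^ (2 * Suc j) * h j x) \<in> homogeneous_polys l" if "j \<le> m div 2" for j
    proof -
      have "2 * Suc j + (m - 2 * j) = l" using that l by simp
      then show ?thesis
        using homogeneous_polys_mult[OF homogeneous_polys_norm_power[of "Suc j"], of "h j" "m - 2 * j"]
          h[OF that] by (simp add: Harm_def)
    qed
    have g: "g \<in> homogeneous_polys l"
      unfolding g_def using H by (intro homogeneous_polys_sum homogeneous_polys_scale) auto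
    have "laplacian g x = (\<Sum>j\<le>m div 2. - inverse (d j) * (d j * (norm x ^ (2 * j) * h j x)))" for x
      unfolding g_def
    proof (subst laplacian_sum[where l = l])
      show "(\<Sum>j\<le>m div 2. laplacian (\<lambda>x. - inverse (d j) * (norm x ^ (2 * Suc j) * h j x)) x)
          = (\<Sum>j\<le>m div 2. - inverse (d j) * (d j * (norm x ^ (2 * j) * h j x)))"
        by (intro sum.cong refl, subst laplacian_scale[OF H], simp, subst d(2)) simp_all
      show "(\<lambda>x. - inverse (d j) * (norm x ^ (2 * Suc j) * h j x)) \<in> homogeneous_polys l"
        if "j \<in> {..m div 2}" for j
        using that by (intro homogeneous_polys_scale H) simp
    qed simp
    also have "\<dots> x = (\<Sum>j\<le>m div 2. - (norm x ^ (2 * j) * h j x))" for x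
      by (rule sum.cong[OF refl]) (use d(1) in \<open>fastforce\<close>)
    finally have "laplacian g x = - laplacian f x" for x
      by (simp add: f sum_negf)
    then have harm: "(\<lambda>x. f x + g x) \<in> Harm l"
      using less(2) g by (auto simp: Harm_def laplacian_add homogeneous_polys_add)
    \<comment> \<open>The harmonic remainder becomes component 0 and component \<open>i\<close> of
      the Laplacian moves to \<open>i + 1\<close>. The shift accounts for the extra factor |x|^2,
      and \<open>l - 2 * Suc i\<close> is again \<open>m - 2 * i\<close>.\<close>
    define k where "k j = (case j of 0 \<Rightarrow> \<lambda>x. f x + g x | Suc i \<Rightarrow> \<lambda>x. inverse (d i) * h i x)" for j
    have "k j \<in> Harm (l - 2 * j)" if "j \<le> l div 2" for j
    proof (cases j)
      case 0
      then show ?thesis using harm by (simp add: k_def)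
    next
      case (Suc i)
      then have "h i \<in> Harm (l - 2 * j)" using h[of i] that l by simp
      then show ?thesis
        unfolding k_def Suc by (auto simp: Harm_def laplacian_scale intro: homogeneous_polys_scale)
    qed
    moreover have "f x = (\<Sum>j\<le>l div 2. norm x ^ (2 * j) * k j x)" for x
    proof -
      have "(\<Sum>j\<le>Suc (m div 2). norm x ^ (2 * j) * k j x)
          = (f x + g x) + (\<Sum>j\<le>m div 2. norm x ^ (2 * Suc j) * (inverse (d j) * h j x))"
        by (subst sum.atMost_Suc_shift) (simp add: k_def)
      also have "\<dots> = f x"
        unfolding g_def by (simp add: sum_negf mult.left_commute)
      finally show ?thesis using l by simp
    qed
    ultimately show ?thesis by blast
  qed
qed

text \<open>By the chain rule the Hessian is conjugated by the matrix of \<open>R\<close>, and the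
  Laplacian, being the trace of the Hessian, is unchanged by an orthogonal conjugation.\<close>

lemma Harm_compose_orthogonal:
  fixes f :: "real ^ 'n::finite \<Rightarrow> real" and R :: "real ^ 'n \<Rightarrow> real ^ 'n"
  assumes f: "f \<in> Harm l" and R: "orthogonal_transformation R"
  shows "(\<lambda>x. f (R x)) \<in> Harm l"
proof -
  have lin: "linear R" using R by (rule orthogonal_transformation_linear)
  have fH: "f \<in> homogeneous_polys l" using f by (simp add: Harm_def)
  have chain: "partial_deriv i (\<lambda>x. g (R x)) x = (\<Sum>k\<in>UNIV. R (axis i 1) $ k * partial_deriv k g (R x))"
    if "g \<in> homogeneous_polys m" for g m i x
    using partial_deriv_eqI[OF has_derivative_compose[OF linear_imp_has_derivative[OF lin]
          has_derivative_partial_deriv[OF homogeneous_polys_differentiable[OF that]]]] .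
  \<comment> \<open>\<open>R (axis i 1)\<close> is column \<open>i\<close> of the matrix of
    \<open>R\<close>. The sum runs over columns, hence this is an entry of the matrix times its
    transpose, in that order.\<close>
  have orth: "(\<Sum>i\<in>UNIV. R (axis i 1) $ k * R (axis i 1) $ m) = (if k = m then 1 else 0)" for k m
  proof -
    have "matrix R ** transpose (matrix R) = mat 1"
      using R by (simp add: orthogonal_transformation_matrix orthogonal_matrix_def)
    then have "(matrix R ** transpose (matrix R)) $ k $ m = mat 1 $ k $ m" by simp
    then show ?thesis by (simp add: matrix_matrix_mult_def transpose_def matrix_def mat_def)
  qed
  have D: "partial_deriv k f \<in> homogeneous_polys (l - 1)" for k
    using homogeneous_polys_partial_deriv[OF fH] by blast
  have DR: "(\<lambda>x. partial_deriv k f (R x)) differentiable (at x)" for k x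
    using homogeneous_polys_compose_linear[OF D lin] homogeneous_polys_differentiable by blast
  have "partial_deriv i (partial_deriv i (\<lambda>x. f (R x))) x
      = (\<Sum>k\<in>UNIV. \<Sum>m\<in>UNIV. R (axis i 1) $ k * R (axis i 1) $ m * partial_deriv m (partial_deriv k f) (R x))" for i x
  proof -
    have "partial_deriv i (\<lambda>x. f (R x)) = (\<lambda>x. \<Sum>k\<in>UNIV. R (axis i 1) $ k * partial_deriv k f (R x))"
      using chain[OF fH] by blast
    then show ?thesis
      by (simp add: partial_deriv_sum partial_deriv_scale DR chain[OF D] sum_distrib_left mult.assoc)
  qed
  then have "laplacian (\<lambda>x. f (R x)) x
      = (\<Sum>i\<in>UNIV. \<Sum>k\<in>UNIV. \<Sum>m\<in>UNIV.
          R (axis i 1) $ k * R (axis i 1) $ m * partial_deriv m (partial_deriv k f) (R x))" for x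
    by (simp add: laplacian_def)
  also have "\<dots> x = (\<Sum>k\<in>UNIV. \<Sum>m\<in>UNIV. (\<Sum>i\<in>UNIV. R (axis i 1) $ k * R (axis i 1) $ m)
      * partial_deriv m (partial_deriv k f) (R x))" for x
    by (subst sum.swap, subst sum.swap) (simp add: sum_distrib_right)
  also have "\<dots> x = laplacian f (R x)" for x
    unfolding orth laplacian_def by (simp add: if_distrib[of "\<lambda>u. u * _"] cong: if_cong)
  finally show ?thesis
    using f fH lin by (simp add: Harm_def homogeneous_polys_compose_linear)
qed

section \<open>Spherical integrals of harmonic polynomials\<close>

lemma nn_integral_lborel_translate:
  fixes f :: "'a::euclidean_space \<Rightarrow> ennreal"
  assumes [measurable]: "f \<in> borel_measurable borel"
  shows "(\<integral>\<^sup>+ x. f (c + x) \<partial>lborel) = (\<integral>\<^sup>+ x. f x \<partial>lborel)"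
proof -
  have "(\<integral>\<^sup>+ x. f x \<partial>distr lborel borel ((+) c)) = (\<integral>\<^sup>+ x. f (c + x) \<partial>lborel)"
    by (rule nn_integral_distr) auto
  then show ?thesis by (simp add: lborel_distr_plus)
qed

text \<open>The library's \<open>measure_orthogonal_image\<close> needs a wellordered index type. Here
  \<open>\<lambda>(R\<^bsup>-1\<^esup> A) \<lambda>(B) = \<lambda>(A) \<lambda>(B)\<close>, for \<open>B\<close> the unit ball, follows from Fubini and translation
  invariance alone.\<close>

lemma lborel_distr_orthogonal:
  fixes R :: "'a::euclidean_space \<Rightarrow> 'a"
  assumes R: "orthogonal_transformation R"
  shows "distr lborel borel R = lborel"
proof (rule measure_eqI)
  fix A :: "'a set" assume "A \<in> sets (distr lborel borel R)"
  then have A [measurable]: "A \<in> sets borel" by simp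
  have lin: "linear R" using R by (rule orthogonal_transformation_linear)
  have R_meas [measurable]: "R \<in> borel_measurable borel"
    using lin by (intro borel_measurable_continuous_onI linear_continuous_on linear_conv_bounded_linear[THEN iffD1])
  define B :: "'a set" where "B = cball 0 1"
  have B_meas [measurable]: "B \<in> sets borel" by (simp add: B_def)
  \<comment> \<open>The ball is symmetric about the origin and \<open>R\<close> preserves norms;
    this absorbs both the sign and the rotation left over after the two translations below.\<close>
  have B: "indicator B (- R x) = (indicator B x :: ennreal)" for x
    using orthogonal_transformation_norm[OF R, of x] by (simp add: B_def indicator_def)
  have "emeasure lborel (R -` A) * emeasure lborel B
      = (\<integral>\<^sup>+ x. indicator A (R x) \<partial>lborel) * (\<integral>\<^sup>+ y. indicator B y \<partial>lborel)"
  proof -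
    have "(\<integral>\<^sup>+ x. indicator A (R x) \<partial>lborel) = (\<integral>\<^sup>+ x. indicator (R -` A) x \<partial>lborel)"
      by (intro nn_integral_cong) (simp add: indicator_def)
    moreover have "R -` A \<in> sets borel"
      using measurable_sets[OF R_meas A] by simp
    ultimately show ?thesis by simp
  qed
  also have "\<dots> = (\<integral>\<^sup>+ x. \<integral>\<^sup>+ y. indicator A (R x) * indicator B y \<partial>lborel \<partial>lborel)"
    by (simp add: nn_integral_cmult nn_integral_multc)
  \<comment> \<open>The inner variable is translated by \<open>- R x\<close>, which couples
    \<open>x\<close> and \<open>y\<close>, so that after exchanging the integrals \<open>x\<close>
    can be translated in turn.\<close>
  also have "\<dots> = (\<integral>\<^sup>+ x. \<integral>\<^sup>+ y. indicator A (R x) * indicator B (- R x + y) \<partial>lborel \<partial>lborel)"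
  proof (rule nn_integral_cong)
    fix x
    show "(\<integral>\<^sup>+ y. indicator A (R x) * indicator B y \<partial>lborel)
        = (\<integral>\<^sup>+ y. indicator A (R x) * indicator B (- R x + y) \<partial>lborel)"
      using nn_integral_lborel_translate[of "\<lambda>y. indicator A (R x) * indicator B y" "- R x"] by simp
  qed
  also have "\<dots> = (\<integral>\<^sup>+ y. \<integral>\<^sup>+ x. indicator A (R x) * indicator B (- R x + y) \<partial>lborel \<partial>lborel)"
    by (rule lborel_pair.Fubini') measurable
  also have "\<dots> = (\<integral>\<^sup>+ y. \<integral>\<^sup>+ x. indicator A (y + R x) * indicator B x \<partial>lborel \<partial>lborel)"
  proof (rule nn_integral_cong)
    fix y
    \<comment> \<open>Translating \<open>x\<close> by a preimage \<open>z\<close> of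
      \<open>y\<close> moves \<open>y\<close> from \<open>B\<close> into \<open>A\<close>:
      \<open>R (z + x)\<close> is \<open>y + R x\<close>, while \<open>- R (z + x) + y\<close> is
      \<open>- R x\<close>.\<close>
    obtain z where z: "R z = y" using orthogonal_transformation_surj[OF R] by (metis surjD)
    have "(\<integral>\<^sup>+ x. indicator A (R x) * indicator B (- R x + y) \<partial>lborel)
        = (\<integral>\<^sup>+ x. indicator A (R (z + x)) * indicator B (- R (z + x) + y) \<partial>lborel)"
      by (rule nn_integral_lborel_translate[symmetric]) measurable
    then show "(\<integral>\<^sup>+ x. indicator A (R x) * indicator B (- R x + y) \<partial>lborel)
        = (\<integral>\<^sup>+ x. indicator A (y + R x) * indicator B x \<partial>lborel)"
      by (simp add: linear_add[OF lin] z B)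
  qed
  also have "\<dots> = (\<integral>\<^sup>+ x. \<integral>\<^sup>+ y. indicator A (y + R x) * indicator B x \<partial>lborel \<partial>lborel)"
    by (rule lborel_pair.Fubini'[symmetric]) measurable
  also have "\<dots> = (\<integral>\<^sup>+ x. emeasure lborel A * indicator B x \<partial>lborel)"
  proof (rule nn_integral_cong)
    fix x
    have "(\<integral>\<^sup>+ y. indicator A (R x + y) * indicator B x \<partial>lborel) = (\<integral>\<^sup>+ y. indicator A y * indicator B x \<partial>lborel)"
      by (rule nn_integral_lborel_translate[where f = "\<lambda>y. indicator A y * indicator B x"]) measurable
    then show "(\<integral>\<^sup>+ y. indicator A (y + R x) * indicator B x \<partial>lborel) = emeasure lborel A * indicator B x"
      by (simp add: add.commute nn_integral_multc)
  qed
  also have "\<dots> = emeasure lborel A * emeasure lborel B"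
    by (simp add: nn_integral_cmult)
  finally have "emeasure lborel (R -` A) * emeasure lborel B = emeasure lborel A * emeasure lborel B" .
  moreover have "emeasure lborel B \<noteq> 0" "emeasure lborel B \<noteq> \<infinity>"
    using content_cball_pos[of 1 "0 :: 'a"] emeasure_lborel_cball_finite[of "0 :: 'a" 1]
    by (auto simp: B_def measure_def)
  ultimately have "emeasure lborel (R -` A) = emeasure lborel A"
    by (simp add: ennreal_mult_cancel_left mult.commute[of _ "emeasure lborel B"])
  then show "emeasure (distr lborel borel R) A = emeasure lborel A"
    by (simp add: emeasure_distr)
qed simp

lemma space_sphere_measure: "space (sphere_measure \<rho>) = sphere 0 \<rho>"
  by (simp add: sphere_measure_def space_scale_measure space_restrict_space)

lemma sets_sphere_measure [measurable_cong]:
  "sets (sphere_measure \<rho>) = sets (restrict_space borel (sphere 0 \<rho>))"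
  by (simp add: sphere_measure_def)

lemma emeasure_sphere_measure_sphere:
  assumes "\<rho> > 0"
  shows "emeasure (sphere_measure \<rho> :: (real ^ 'n::finite) measure) (sphere 0 \<rho>)
    = ennreal (real CARD('n) / \<rho>) * emeasure lborel (cball (0 :: real ^ 'n) \<rho> - {0})"
proof -
  have "{s *\<^sub>R x | s x. x \<in> sphere (0 :: real ^ 'n) \<rho> \<and> 0 < s \<and> s \<le> 1} = cball 0 \<rho> - {0}"
  proof (intro equalityI subsetI)
    fix y :: "real ^ 'n" assume "y \<in> cball 0 \<rho> - {0}"
    then have "y = (norm y / \<rho>) *\<^sub>R ((\<rho> / norm y) *\<^sub>R y) \<and> (\<rho> / norm y) *\<^sub>R y \<in> sphere 0 \<rho>
        \<and> 0 < norm y / \<rho> \<and> norm y / \<rho> \<le> 1"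
      using assms by auto
    then show "y \<in> {s *\<^sub>R x | s x. x \<in> sphere (0 :: real ^ 'n) \<rho> \<and> 0 < s \<and> s \<le> 1}" by blast
  qed (use assms in \<open>auto simp: mult_left_le_one_le\<close>)
  then show ?thesis
    using emeasure_sphere_measure[OF assms, of "sphere (0 :: real ^ 'n) \<rho>"] by simp
qed

text \<open>Up to the factor \<open>n / \<rho>\<close> the total mass is the volume of the ball.
  Finiteness makes continuous functions integrable; positivity is what normalises the average of a
  constant.\<close>

lemma
  assumes "\<rho> > 0"
  shows finite_measure_sphere_measure: "finite_measure (sphere_measure \<rho> :: (real ^ 'n::finite) measure)"
    and measure_sphere_measure_pos: "measure (sphere_measure \<rho>) (sphere (0 :: real ^ 'n) \<rho>) > 0"
proof -
  have ball: "emeasure lborel (cball (0 :: real ^ 'n) \<rho> - {0}) = emeasure lborel (cball (0 :: real ^ 'n) \<rho>)"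
    by (rule emeasure_Diff_null_set) auto
  have fin: "emeasure lborel (cball (0 :: real ^ 'n) \<rho>) < \<infinity>"
    by (rule emeasure_lborel_cball_finite)
  show "finite_measure (sphere_measure \<rho> :: (real ^ 'n) measure)"
    using fin assms
    by (intro finite_measureI)
      (simp add: space_sphere_measure emeasure_sphere_measure_sphere ball ennreal_mult_eq_top_iff less_top)
  show "measure (sphere_measure \<rho>) (sphere (0 :: real ^ 'n) \<rho>) > 0"
    using content_cball_pos[of \<rho> "0 :: real ^ 'n"] assms
    by (simp add: measure_def emeasure_sphere_measure_sphere ball enn2real_mult)
qed

lemma borel_measurable_sphere_measure:
  fixes f :: "real ^ 'n::finite \<Rightarrow> real"
  assumes "continuous_on UNIV f"
  shows "f \<in> borel_measurable (sphere_measure \<rho>)"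
  using borel_measurable_continuous_onI[OF assms]
  by (simp add: measurable_cong_sets[OF sets_sphere_measure refl] measurable_restrict_space1)

lemma integrable_sphere_measure:
  fixes f :: "real ^ 'n::finite \<Rightarrow> real"
  assumes "\<rho> > 0" and f: "continuous_on UNIV f"
  shows "integrable (sphere_measure \<rho>) f"
proof -
  interpret finite_measure "sphere_measure \<rho> :: (real ^ 'n) measure"
    by (rule finite_measure_sphere_measure[OF assms(1)])
  have "bounded (f ` sphere 0 \<rho>)"
    using f by (intro compact_imp_bounded compact_continuous_image) (auto intro: continuous_on_subset)
  then obtain C where "\<And>x. x \<in> sphere 0 \<rho> \<Longrightarrow> norm (f x) \<le> C"
    unfolding bounded_iff by blast
  then show ?thesis
    by (intro integrable_const_bound[of _ C] borel_measurable_sphere_measure f AE_I2)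
      (simp add: space_sphere_measure)
qed

text \<open>\<open>R\<close> commutes with scaling and preserves norms, so the preimage of the cone
  over \<open>A\<close> is the cone over the preimage of \<open>A\<close>; invariance of Lebesgue
  measure does the rest.\<close>

lemma sphere_measure_distr_orthogonal:
  fixes R :: "real ^ 'n::finite \<Rightarrow> real ^ 'n"
  assumes \<rho>: "\<rho> > 0" and R: "orthogonal_transformation R"
  shows "distr (sphere_measure \<rho>) (sphere_measure \<rho>) R = sphere_measure \<rho>"
    and "R \<in> measurable (sphere_measure \<rho>) (sphere_measure \<rho>)"
proof -
  have lin: "linear R" using R by (rule orthogonal_transformation_linear)
  have norm_R: "norm (R x) = norm x" for x using R by (rule orthogonal_transformation_norm)
  have R_zero: "R x = 0 \<longleftrightarrow> x = 0" for x by (metis norm_R norm_eq_zero)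
  have R_meas [measurable]: "R \<in> borel_measurable borel"
    using lin by (intro borel_measurable_continuous_onI linear_continuous_on linear_conv_bounded_linear[THEN iffD1])
  show meas: "R \<in> measurable (sphere_measure \<rho>) (sphere_measure \<rho>)"
    unfolding measurable_cong_sets[OF sets_sphere_measure sets_sphere_measure]
    by (intro measurable_restrict_space3 R_meas) (auto simp: norm_R)
  show "distr (sphere_measure \<rho>) (sphere_measure \<rho>) R = sphere_measure \<rho>"
  proof (rule measure_eqI)
    fix A assume "A \<in> sets (distr (sphere_measure \<rho>) (sphere_measure \<rho>) R)"
    then have A_sets: "A \<in> sets (sphere_measure \<rho>)" by simp
    then have A: "A \<in> sets borel" "A \<subseteq> sphere 0 \<rho>"
      by (auto simp: sets_sphere_measure sets_restrict_space_iff)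
    let ?cone = "\<lambda>A :: (real ^ 'n) set. {s *\<^sub>R x | s x. x \<in> A \<and> 0 < s \<and> s \<le> 1}"
    \<comment> \<open>Describing the cone by the radial projection of the point itself exhibits it
      as a Borel set and makes its preimage under \<open>R\<close> computable.\<close>
    have cone: "?cone A = {y. y \<noteq> 0 \<and> norm y \<le> \<rho> \<and> (\<rho> / norm y) *\<^sub>R y \<in> A}"
      if "A \<subseteq> sphere 0 \<rho>" for A :: "(real ^ 'n) set"
    proof (intro equalityI subsetI)
      fix y assume "y \<in> {y. y \<noteq> 0 \<and> norm y \<le> \<rho> \<and> (\<rho> / norm y) *\<^sub>R y \<in> A}"
      then have "y = (norm y / \<rho>) *\<^sub>R ((\<rho> / norm y) *\<^sub>R y) \<and> (\<rho> / norm y) *\<^sub>R y \<in> A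
          \<and> 0 < norm y / \<rho> \<and> norm y / \<rho> \<le> 1"
        using \<rho> by auto
      then show "y \<in> ?cone A" by blast
    next
      fix y assume "y \<in> ?cone A"
      then obtain s x where "y = s *\<^sub>R x" "x \<in> A" "0 < s" "s \<le> 1" by blast
      then show "y \<in> {y. y \<noteq> 0 \<and> norm y \<le> \<rho> \<and> (\<rho> / norm y) *\<^sub>R y \<in> A}"
        using that \<rho> by (auto simp: mult_left_le_one_le)
    qed
    have RA: "R -` A \<in> sets borel" "R -` A \<subseteq> sphere 0 \<rho>"
      using measurable_sets[OF R_meas A(1)] A(2) norm_R by fastforce+
    have "emeasure (distr (sphere_measure \<rho>) (sphere_measure \<rho>) R) A = emeasure (sphere_measure \<rho>) (R -` A)"
      using RA(2) by (simp add: emeasure_distr[OF meas A_sets] space_sphere_measure Int_absorb2)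
    also have "\<dots> = ennreal (real CARD('n) / \<rho>) * emeasure lborel (?cone (R -` A))"
      by (rule emeasure_sphere_measure[OF \<rho> RA])
    also have "?cone (R -` A) = R -` ?cone A"
      unfolding cone[OF RA(2)] cone[OF A(2)]
      by (auto simp: linear_scale[OF lin] norm_R R_zero)
    also have "emeasure lborel (R -` ?cone A) = emeasure (distr lborel borel R) (?cone A)"
    proof -
      have "{y. y \<noteq> 0 \<and> norm y \<le> \<rho> \<and> (\<rho> / norm y) *\<^sub>R y \<in> A} \<in> sets borel"
        using A(1) by measurable
      then show ?thesis unfolding cone[OF A(2)] by (simp add: emeasure_distr)
    qed
    also have "\<dots> = emeasure lborel (?cone A)"
      by (simp add: lborel_distr_orthogonal[OF R])
    also have "ennreal (real CARD('n) / \<rho>) * emeasure lborel (?cone A) = emeasure (sphere_measure \<rho>) A"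
      by (rule emeasure_sphere_measure[OF \<rho> A, symmetric])
    finally show "emeasure (distr (sphere_measure \<rho>) (sphere_measure \<rho>) R) A = emeasure (sphere_measure \<rho>) A" .
  qed simp
qed

lemma integral_sphere_measure_orthogonal:
  fixes R :: "real ^ 'n::finite \<Rightarrow> real ^ 'n" and f :: "real ^ 'n \<Rightarrow> real"
  assumes "\<rho> > 0" "orthogonal_transformation R" "continuous_on UNIV f"
  shows "(LINT x|sphere_measure \<rho>. f (R x)) = (LINT x|sphere_measure \<rho>. f x)"
  using integral_distr[OF sphere_measure_distr_orthogonal(2) borel_measurable_sphere_measure, OF assms]
  by (simp add: sphere_measure_distr_orthogonal(1) assms)

section \<open>Rotation fields and vanishing spherical means\<close>

text \<open>Written as a correction of the identity along two axes, which avoids a case distinction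
  on the coordinate and keeps linearity and the derivative in \<open>\<theta>\<close> immediate. It
  is the rotation by \<open>\<theta>\<close> only when \<open>i \<noteq> j\<close>.\<close>

definition plane_rotation :: "'n \<Rightarrow> 'n \<Rightarrow> real \<Rightarrow> real ^ 'n \<Rightarrow> real ^ 'n::finite" where
  "plane_rotation i j \<theta> x = x + ((cos \<theta> - 1) * x $ i - sin \<theta> * x $ j) *\<^sub>R axis i 1
    + (sin \<theta> * x $ i + (cos \<theta> - 1) * x $ j) *\<^sub>R axis j 1"

lemma plane_rotation_nth:
  assumes "i \<noteq> j"
  shows "plane_rotation i j \<theta> x $ i = cos \<theta> * x $ i - sin \<theta> * x $ j"
    and "plane_rotation i j \<theta> x $ j = sin \<theta> * x $ i + cos \<theta> * x $ j"
  using assms by (simp_all add: plane_rotation_def axis_def algebra_simps)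

lemma plane_rotation_zero: "plane_rotation i j 0 x = x"
  by (simp add: plane_rotation_def)

lemma orthogonal_transformation_plane_rotation:
  assumes "i \<noteq> j"
  shows "orthogonal_transformation (plane_rotation i j \<theta>)"
  unfolding orthogonal_transformation
proof (intro conjI allI)
  show "linear (plane_rotation i j \<theta>)"
    by (rule linearI) (simp_all add: plane_rotation_def algebra_simps)
  fix x :: "real ^ 'a"
  let ?a = "(cos \<theta> - 1) * x $ i - sin \<theta> * x $ j" and ?b = "sin \<theta> * x $ i + (cos \<theta> - 1) * x $ j"
  have "axis i (1 :: real) \<bullet> axis j 1 = 0" "axis j (1 :: real) \<bullet> axis i 1 = 0"
    using assms by (simp_all add: inner_axis_axis)
  then have "plane_rotation i j \<theta> x \<bullet> plane_rotation i j \<theta> x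
      = x \<bullet> x + (2 * ?a * x $ i + 2 * ?b * x $ j + ?a\<^sup>2 + ?b\<^sup>2)"
    by (simp add: plane_rotation_def inner_add_left inner_add_right inner_axis inner_axis' inner_axis_axis
        power2_eq_square algebra_simps)
  also have "2 * ?a * x $ i + 2 * ?b * x $ j + ?a\<^sup>2 + ?b\<^sup>2
      = ((sin \<theta>)\<^sup>2 + (cos \<theta>)\<^sup>2 - 1) * ((x $ i)\<^sup>2 + (x $ j)\<^sup>2)"
    by algebra
  finally show "norm (plane_rotation i j \<theta> x) = norm x"
    by (simp add: norm_eq_sqrt_inner)
qed

text \<open>Rotation moves a point with velocity (-y_j, y_i) in the chosen plane. The derivative is
  computed at every angle, not only at 0, because the mean value theorem is applied to it
  later.\<close>

lemma plane_rotation_has_derivative: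
  fixes f :: "real ^ 'n::finite \<Rightarrow> real"
  assumes ij: "i \<noteq> j" and f: "\<And>y. f differentiable (at y)"
  defines "V \<equiv> \<lambda>y. y $ i * partial_deriv j f y - y $ j * partial_deriv i f y"
  shows "((\<lambda>\<theta>. f (plane_rotation i j \<theta> x)) has_real_derivative V (plane_rotation i j \<theta> x)) (at \<theta>)"
proof -
  let ?y = "plane_rotation i j \<theta> x"
  have "((\<lambda>\<theta>. plane_rotation i j \<theta> x) has_derivative
      (\<lambda>h. (h * (- ?y $ j)) *\<^sub>R axis i 1 + (h * ?y $ i) *\<^sub>R axis j 1)) (at \<theta>)"
    unfolding plane_rotation_nth[OF ij] unfolding plane_rotation_def
    by (auto intro!: derivative_eq_intros simp: algebra_simps)
  from has_derivative_compose[OF this has_derivative_partial_deriv[OF f]]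
  have "((\<lambda>\<theta>. f (plane_rotation i j \<theta> x)) has_derivative
      (\<lambda>h. \<Sum>k\<in>UNIV. ((h * (- ?y $ j)) *\<^sub>R axis i 1 + (h * ?y $ i) *\<^sub>R axis j 1) $ k * partial_deriv k f ?y)) (at \<theta>)" .
  moreover have "(\<Sum>k\<in>UNIV. ((h * (- ?y $ j)) *\<^sub>R axis i 1 + (h * ?y $ i) *\<^sub>R axis j 1) $ k * partial_deriv k f ?y)
      = V ?y * h" for h
    by (simp add: V_def axis_def distrib_right sum.distrib sum_subtractf if_distrib[of "\<lambda>u. u * _"] if_distrib[of "\<lambda>u. _ * u"]
        algebra_simps cong: if_cong)
  ultimately show ?thesis by (simp add: has_field_derivative_def mult_commute_abs)
qed

text \<open>The difference quotients of \<open>f\<close> along the rotation have integral 0 by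
  invariance, and they converge pointwise to the rotation field; dominated convergence carries the 0
  to the limit.\<close>

lemma integral_sphere_measure_rotation_field:
  fixes f :: "real ^ 'n::finite \<Rightarrow> real"
  assumes \<rho>: "\<rho> > 0" and f: "f \<in> homogeneous_polys l"
  shows "(LINT x|sphere_measure \<rho>. x $ i * partial_deriv j f x - x $ j * partial_deriv i f x) = 0"
proof (cases "i = j")
  case False
  define V where "V y = y $ i * partial_deriv j f y - y $ j * partial_deriv i f y" for y
  have D: "partial_deriv k f \<in> homogeneous_polys (l - 1)" for k
    using homogeneous_polys_partial_deriv[OF f] by blast
  have cont_V: "continuous_on S V" for S
    unfolding V_def using homogeneous_polys_continuous_on[OF D] by (auto intro!: continuous_intros)
  have cont_f: "continuous_on S f" for S by (rule homogeneous_polys_continuous_on[OF f])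
  let ?R = "plane_rotation i j" and ?M = "sphere_measure \<rho> :: (real ^ 'n) measure"
  have R: "orthogonal_transformation (?R \<theta>)" for \<theta>
    by (rule orthogonal_transformation_plane_rotation[OF False])
  have cont_R: "continuous_on S (?R \<theta>)" for S \<theta>
    using orthogonal_transformation_linear[OF R] by (simp add: linear_continuous_on linear_conv_bounded_linear)
  have cont_fR: "continuous_on UNIV (\<lambda>x. f (?R \<theta> x))" for \<theta>
    by (rule continuous_on_compose2[OF cont_f cont_R]) auto
  have deriv: "((\<lambda>\<theta>. f (?R \<theta> x)) has_real_derivative V (?R \<theta> x)) (at \<theta>)" for x \<theta>
    unfolding V_def by (rule plane_rotation_has_derivative[OF False homogeneous_polys_differentiable[OF f]])
  have "bounded (V ` sphere 0 \<rho>)"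
    using cont_V by (intro compact_imp_bounded compact_continuous_image) auto
  then obtain C where C: "\<And>x. x \<in> sphere 0 \<rho> \<Longrightarrow> norm (V x) \<le> C"
    unfolding bounded_iff by blast
  define q where "q n x = (f (?R (inverse (real (Suc n))) x) - f x) / inverse (real (Suc n))" for n x
  have "(\<lambda>n. LINT x|?M. q n x) \<longlonglongrightarrow> (LINT x|?M. V x)"
  proof (rule integral_dominated_convergence[where w = "\<lambda>_. C"])
    show "V \<in> borel_measurable ?M" by (rule borel_measurable_sphere_measure[OF cont_V])
    show "q n \<in> borel_measurable ?M" for n
      unfolding q_def by (intro borel_measurable_sphere_measure continuous_intros cont_fR cont_f) simp
    show "integrable ?M (\<lambda>_. C)" by (rule integrable_sphere_measure[OF \<rho>]) simp
    show "AE x in ?M. (\<lambda>n. q n x) \<longlonglongrightarrow> V x"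
    proof (rule AE_I2)
      fix x
      have "((\<lambda>h. (f (?R (0 + h) x) - f (?R 0 x)) / h) \<longlongrightarrow> V (?R 0 x)) (at 0)"
        using deriv[of x 0] by (simp add: DERIV_def)
      moreover have "filterlim (\<lambda>n. inverse (real (Suc n))) (at 0) sequentially"
        using LIMSEQ_inverse_real_of_nat by (auto simp: filterlim_at)
      ultimately show "(\<lambda>n. q n x) \<longlonglongrightarrow> V x"
        unfolding q_def by (auto dest: filterlim_compose simp: plane_rotation_zero)
    qed
    show "AE x in ?M. norm (q n x) \<le> C" for n
    proof (rule AE_I2)
      fix x assume "x \<in> space ?M"
      then have x: "x \<in> sphere 0 \<rho>" by (simp add: space_sphere_measure)
      \<comment> \<open>By the mean value theorem the quotient is a value of \<open>V\<close> at a
        rotated point, which is still on the sphere; hence the bound \<open>C\<close> serves every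
        \<open>n\<close>.\<close>
      obtain z where "f (?R (inverse (real (Suc n))) x) - f (?R 0 x) = (inverse (real (Suc n)) - 0) * V (?R z x)"
        using MVT2[of 0 "inverse (real (Suc n))" "\<lambda>\<theta>. f (?R \<theta> x)" "\<lambda>\<theta>. V (?R \<theta> x)"] deriv by auto
      then have "q n x = V (?R z x)" by (simp add: q_def plane_rotation_zero)
      then show "norm (q n x) \<le> C"
        using C[of "?R z x"] x orthogonal_transformation_norm[OF R] by simp
    qed
  qed
  moreover have "(LINT x|?M. q n x) = 0" for n
    unfolding q_def
    using integral_sphere_measure_orthogonal[OF \<rho> R cont_f] integrable_sphere_measure[OF \<rho> cont_f]
      integrable_sphere_measure[OF \<rho> cont_fR]
    by simp
  ultimately have "(LINT x|?M. V x) = 0" by (simp add: LIMSEQ_const_iff)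
  then show ?thesis by (simp add: V_def)
qed simp

text \<open>The integral of the left-hand side vanishes by the previous lemma.\<close>

lemma sum_rotation_field_harmonic:
  fixes \<phi> :: "real ^ 'n::finite \<Rightarrow> real"
  assumes \<phi>: "\<phi> \<in> Harm l"
  shows "(\<Sum>i\<in>UNIV. \<Sum>j\<in>UNIV. x $ i * partial_deriv j (\<lambda>x. x $ i * partial_deriv j \<phi> x) x
      - x $ j * partial_deriv i (\<lambda>x. x $ i * partial_deriv j \<phi> x) x)
    = - (real l * (real l + real CARD('n) - 2)) * \<phi> x"
proof -
  have H: "\<phi> \<in> homogeneous_polys l" using \<phi> by (simp add: Harm_def)
  have D: "partial_deriv j \<phi> \<in> homogeneous_polys (l - 1)" for j
    using homogeneous_polys_partial_deriv[OF H] by blast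
  have prod: "partial_deriv k (\<lambda>x. x $ i * partial_deriv j \<phi> x) x
      = (if k = i then partial_deriv j \<phi> x else 0) + x $ i * partial_deriv k (partial_deriv j \<phi>) x" for i j k
    by (subst partial_deriv_mult)
      (auto simp: partial_deriv_coord homogeneous_polys_differentiable[OF D]
        homogeneous_polys_differentiable[OF homogeneous_polys_coord])
  \<comment> \<open>Euler's identity for a derivative of degree \<open>l - 1\<close>. For
    \<open>l = 0\<close> the truncated degree differs from the real factor \<open>l - 1\<close>, but
    then the derivative is zero.\<close>
  have inner: "(\<Sum>i\<in>UNIV. x $ i * partial_deriv i (partial_deriv j \<phi>) x) = (real l - 1) * partial_deriv j \<phi> x" for j
  proof (cases l)
    case 0
    then show ?thesis
      using homogeneous_polys_partial_deriv[OF H, of j] by (simp add: partial_deriv_const)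
  qed (use homogeneous_polys_euler[OF D] in simp)
  have "(\<Sum>i\<in>UNIV. \<Sum>j\<in>UNIV. x $ i * partial_deriv j (\<lambda>x. x $ i * partial_deriv j \<phi> x) x)
      = (\<Sum>i\<in>UNIV. x $ i * partial_deriv i \<phi> x + x $ i * x $ i * laplacian \<phi> x)"
    by (simp add: prod distrib_left sum.distrib laplacian_def sum_distrib_left mult.assoc
        if_distrib[of "\<lambda>u. _ * u"] cong: if_cong)
  also have "\<dots> = real l * \<phi> x"
    using \<phi> by (simp add: homogeneous_polys_euler[OF H] Harm_def)
  finally have 1: "(\<Sum>i\<in>UNIV. \<Sum>j\<in>UNIV. x $ i * partial_deriv j (\<lambda>x. x $ i * partial_deriv j \<phi> x) x)
      = real l * \<phi> x" .
  \<comment> \<open>Here \<open>x $ i\<close> is differentiated in its own direction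
    \<open>i\<close>, so the delta term occurs for every pair of indices, and summing over
    \<open>i\<close> produces the dimension.\<close>
  have "(\<Sum>i\<in>UNIV. \<Sum>j\<in>UNIV. x $ j * partial_deriv i (\<lambda>x. x $ i * partial_deriv j \<phi> x) x)
      = (\<Sum>j\<in>UNIV. \<Sum>i\<in>UNIV. x $ j * partial_deriv j \<phi> x + x $ j * (x $ i * partial_deriv i (partial_deriv j \<phi>) x))"
    by (subst sum.swap) (simp add: prod distrib_left)
  also have "\<dots> = (\<Sum>j\<in>UNIV. real CARD('n) * (x $ j * partial_deriv j \<phi> x)
      + (real l - 1) * (x $ j * partial_deriv j \<phi> x))"
    by (simp add: sum.distrib sum_distrib_left[symmetric] inner mult.left_commute)
  also have "\<dots> = (real CARD('n) + real l - 1) * (real l * \<phi> x)"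
    by (simp only: sum.distrib sum_distrib_left[symmetric] homogeneous_polys_euler[OF H])
      (simp add: algebra_simps)
  finally show ?thesis
    using 1 by (simp add: sum_subtractf algebra_simps)
qed

lemma integral_sphere_measure_harmonic:
  fixes \<phi> :: "real ^ 'n::finite \<Rightarrow> real"
  assumes \<rho>: "\<rho> > 0" and \<phi>: "\<phi> \<in> Harm l" and l: "l \<ge> 1"
  shows "(LINT x|sphere_measure \<rho>. \<phi> x) = 0"
proof -
  let ?M = "sphere_measure \<rho> :: (real ^ 'n) measure"
  have H: "\<phi> \<in> homogeneous_polys l" using \<phi> by (simp add: Harm_def)
  define g where "g i j x = x $ i * partial_deriv j \<phi> x" for i j x
  define V where "V i j x = x $ i * partial_deriv j (g i j) x - x $ j * partial_deriv i (g i j) x" for i j x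
  have g: "g i j \<in> homogeneous_polys (Suc (l - 1))" for i j
    unfolding g_def using homogeneous_polys_partial_deriv[OF H] by (intro homogeneous_polys_coord_mult) blast
  have "continuous_on UNIV (partial_deriv k (g i j))" for i j k
    using homogeneous_polys_partial_deriv[OF g] homogeneous_polys_continuous_on by blast
  then have int: "integrable ?M (V i j)" for i j
    unfolding V_def by (intro integrable_sphere_measure[OF \<rho>] continuous_intros)
  have "(LINT x|?M. (\<Sum>i\<in>UNIV. \<Sum>j\<in>UNIV. V i j x)) = (\<Sum>i\<in>UNIV. \<Sum>j\<in>UNIV. LINT x|?M. V i j x)"
    using int by (simp add: Bochner_Integration.integral_sum)
  also have "\<dots> = 0"
    unfolding V_def by (simp add: integral_sphere_measure_rotation_field[OF \<rho> g])
  finally have zero: "(real l * (real l + real CARD('n) - 2)) * (LINT x|?M. \<phi> x) = 0"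
    unfolding V_def g_def sum_rotation_field_harmonic[OF \<phi>] by simp
  show ?thesis
  \<comment> \<open>For \<open>l \<ge> 1\<close> the factor vanishes only if l = n = 1. Oddness
    disposes of \<open>l = 1\<close> in every dimension at once; for \<open>l \<ge> 2\<close> the
    factor is positive since n is at least 1.\<close>
  proof (cases "l = 1")
    case True
    have "(LINT x|?M. \<phi> (- x)) = (LINT x|?M. \<phi> x)"
      by (rule integral_sphere_measure_orthogonal[OF \<rho> _ homogeneous_polys_continuous_on[OF H]])
        (auto simp: orthogonal_transformation linear_iff)
    moreover have "\<phi> (- x) = - \<phi> x" for x
      using homogeneous_polys_scaleR[OF H, of "-1" x] True by simp
    ultimately show ?thesis by simp
  next
    case False
    then have "real l * (real l + real CARD('n) - 2) > 0"
      using l zero_less_card_finite[where 'a = 'n] by (intro mult_pos_pos) linarith+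
    then show ?thesis using zero by (metis less_irrefl mult_eq_0_iff)
  qed
qed

section \<open>Euclidean designs\<close>

lemma sphere_average_sum:
  fixes f :: "'i \<Rightarrow> real ^ 'n::finite \<Rightarrow> real"
  assumes "\<rho> > 0" "\<And>i. i \<in> I \<Longrightarrow> continuous_on UNIV (f i)"
  shows "sphere_average \<rho> (\<lambda>x. \<Sum>i\<in>I. f i x) = (\<Sum>i\<in>I. sphere_average \<rho> (f i))"
proof -
  have "(LINT x|sphere_measure \<rho>. (\<Sum>i\<in>I. f i x)) = (\<Sum>i\<in>I. LINT x|sphere_measure \<rho>. f i x)"
    using assms by (intro Bochner_Integration.integral_sum integrable_sphere_measure) auto
  then show ?thesis
    using assms(1) by (simp add: sphere_average_def sum_divide_distrib)
qed

lemma sphere_average_norm_power_mult: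
  fixes f :: "real ^ 'n::finite \<Rightarrow> real"
  assumes "\<rho> > 0"
  shows "sphere_average \<rho> (\<lambda>x. norm x ^ k * f x) = \<rho> ^ k * sphere_average \<rho> f"
proof -
  have "(LINT x|sphere_measure \<rho>. norm x ^ k * f x) = (LINT x|sphere_measure \<rho>. \<rho> ^ k * f x)"
    by (rule Bochner_Integration.integral_cong) (simp_all add: space_sphere_measure)
  then show ?thesis
    using assms by (simp add: sphere_average_def)
qed

lemma sphere_average_const:
  assumes "\<rho> > 0"
  shows "sphere_average \<rho> (\<lambda>x :: real ^ 'n::finite. c) = c"
  using assms measure_sphere_measure_pos[OF assms, where 'n = 'n]
  by (simp add: sphere_average_def space_sphere_measure)

lemma sphere_average_harmonic:
  assumes "\<rho> > 0" "\<phi> \<in> Harm l" "l \<ge> 1"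
  shows "sphere_average \<rho> \<phi> = 0"
  using assms by (simp add: sphere_average_def integral_sphere_measure_harmonic)

section \<open>Harmonic components of test polynomials\<close>

lemma homogeneous_polys_subset_polys_upto:
  assumes "l \<le> t"
  shows "homogeneous_polys l \<subseteq> (polys_upto t :: (real ^ 'n::finite \<Rightarrow> real) set)"
proof
  fix f :: "real ^ 'n \<Rightarrow> real" assume "f \<in> homogeneous_polys l"
  then obtain c where f: "f = (\<lambda>x. \<Sum>\<alpha> | sum \<alpha> UNIV = l. c \<alpha> * monomial \<alpha> x)"
    unfolding homogeneous_polys_def by blast
  have "f x = (\<Sum>\<alpha> | sum \<alpha> UNIV \<le> t. (if sum \<alpha> UNIV = l then c \<alpha> else 0) * monomial \<alpha> x)" for x
    unfolding f using assms
    by (intro sum.mono_neutral_cong_left finite_multi_indices_le) auto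
  then show "f \<in> polys_upto t"
    unfolding polys_upto_def
    by (intro CollectI exI[of _ "\<lambda>\<alpha>. if sum \<alpha> UNIV = l then c \<alpha> else 0"] ext)
qed

lemma polys_upto_sum_homogeneous:
  fixes f :: "real ^ 'n::finite \<Rightarrow> real"
  assumes "f \<in> polys_upto t"
  shows "\<exists>F. (\<forall>l. F l \<in> homogeneous_polys l) \<and> f = (\<lambda>x. \<Sum>l\<le>t. F l x)"
proof -
  obtain c where f: "f = (\<lambda>x. \<Sum>\<alpha> | sum \<alpha> UNIV \<le> t. c \<alpha> * monomial \<alpha> x)"
    using assms unfolding polys_upto_def by blast
  define F where "F l x = (\<Sum>\<alpha> | sum \<alpha> UNIV = l. c \<alpha> * monomial \<alpha> x)" for l and x :: "real ^ 'n"
  have "F l \<in> homogeneous_polys l" for l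
    unfolding homogeneous_polys_def F_def by blast
  moreover have "f x = (\<Sum>l\<le>t. F l x)" for x
  proof -
    let ?S = "{\<alpha> :: 'n \<Rightarrow> nat. sum \<alpha> UNIV \<le> t}"
    have "(\<Sum>l\<le>t. \<Sum>\<alpha> | \<alpha> \<in> ?S \<and> sum \<alpha> UNIV = l. c \<alpha> * monomial \<alpha> x) = f x"
      unfolding f by (rule sum.group) (auto intro: finite_multi_indices_le)
    moreover have "{\<alpha>. \<alpha> \<in> ?S \<and> sum \<alpha> UNIV = l} = {\<alpha>. sum \<alpha> UNIV = l}" if "l \<le> t" for l
      using that by auto
    ultimately show ?thesis unfolding F_def by simp
  qed
  ultimately show ?thesis by blast
qed

lemma norm_power_mult_homogeneous:
  assumes "h \<in> homogeneous_polys l"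
  shows "(\<lambda>x. norm x ^ (2 * j) * h x) \<in> homogeneous_polys (2 * j + l)"
  by (intro homogeneous_polys_mult homogeneous_polys_norm_power assms)

text \<open>The index \<open>l\<close> is the total degree of the summand, so its harmonic factor
  has degree \<open>l - 2 * j\<close>. A single index set of pairs gives one finite sum to which
  linearity applies.\<close>

lemma polys_upto_harmonic_decomposition:
  fixes f :: "real ^ 'n::finite \<Rightarrow> real"
  assumes "f \<in> polys_upto t"
  shows "\<exists>h. (\<forall>l j. 2 * j \<le> l \<longrightarrow> h l j \<in> Harm (l - 2 * j)) \<and>
    f = (\<lambda>x. \<Sum>(l, j)\<in>(SIGMA l:{..t}. {..l div 2}). norm x ^ (2 * j) * h l j x)"
proof -
  obtain F where F: "\<And>l. F l \<in> homogeneous_polys l" "f = (\<lambda>x. \<Sum>l\<le>t. F l x)"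
    using polys_upto_sum_homogeneous[OF assms] by blast
  have "\<forall>l. \<exists>h. (\<forall>j \<le> l div 2. h j \<in> Harm (l - 2 * j)) \<and>
      F l = (\<lambda>x. \<Sum>j\<le>l div 2. norm x ^ (2 * j) * h j x)"
    using homogeneous_polys_harmonic_decomposition[OF F(1)] by blast
  then obtain h where h: "\<forall>l. (\<forall>j \<le> l div 2. h l j \<in> Harm (l - 2 * j)) \<and>
      F l = (\<lambda>x. \<Sum>j\<le>l div 2. norm x ^ (2 * j) * h l j x)"
    by (rule choice[THEN exE])
  have "f x = (\<Sum>(l, j)\<in>(SIGMA l:{..t}. {..l div 2}). norm x ^ (2 * j) * h l j x)" for x
  proof -
    have "f x = (\<Sum>l\<le>t. \<Sum>j\<le>l div 2. norm x ^ (2 * j) * h l j x)"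
      unfolding F(2) by (intro sum.cong refl) (use h in metis)
    then show ?thesis by (simp add: sum.Sigma)
  qed
  moreover have "h l j \<in> Harm (l - 2 * j)" if "2 * j \<le> l" for l j
    using h that by auto
  ultimately show ?thesis by blast
qed

text \<open>The left-hand side of the design equation, isolated as a functional of \<open>f\<close>:
  being a design then means that two linear functionals agree.\<close>

definition design_average :: "(real ^ 'n::finite) set \<Rightarrow> (real ^ 'n \<Rightarrow> real) \<Rightarrow> (real ^ 'n \<Rightarrow> real) \<Rightarrow> real" where
  "design_average X w f = (\<Sum>\<rho>\<in>norm ` X. (\<Sum>x\<in>X \<inter> sphere 0 \<rho>. w x) * sphere_average \<rho> f)"

lemma design_average_sum:
  assumes "0 \<notin> X" "\<And>i. i \<in> I \<Longrightarrow> continuous_on UNIV (f i)"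
  shows "design_average X w (\<lambda>x. \<Sum>i\<in>I. f i x) = (\<Sum>i\<in>I. design_average X w (f i))"
proof -
  have pos: "\<rho> > 0" if "\<rho> \<in> norm ` X" for \<rho> using that assms(1) by auto
  show ?thesis
    unfolding design_average_def
    by (simp add: pos sphere_average_sum assms(2) sum_distrib_left sum.swap[of _ I])
qed

lemma design_average_harmonic:
  assumes "0 \<notin> X" "\<phi> \<in> Harm l" "l \<ge> 1"
  shows "design_average X w (\<lambda>x. norm x ^ k * \<phi> x) = 0"
proof -
  have pos: "\<rho> > 0" if "\<rho> \<in> norm ` X" for \<rho> using that assms(1) by auto
  show ?thesis
    unfolding design_average_def
    by (simp add: pos sphere_average_norm_power_mult sphere_average_harmonic[OF _ assms(2,3)])
qed

text \<open>On each sphere the function is constant and equals its average; regrouping the points of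
  \<open>X\<close> by norm gives the weighted sum. The factor \<open>c\<close> stands for a harmonic
  polynomial of degree 0.\<close>

lemma design_average_norm_power:
  assumes "0 \<notin> X" "finite X"
  shows "design_average X w (\<lambda>x. norm x ^ k * c) = (\<Sum>x\<in>X. w x * (norm x ^ k * c))"
proof -
  have pos: "\<rho> > 0" if "\<rho> \<in> norm ` X" for \<rho> using that assms(1) by auto
  have "design_average X w (\<lambda>x. norm x ^ k * c) = (\<Sum>\<rho>\<in>norm ` X. \<Sum>x | x \<in> X \<and> norm x = \<rho>. w x * (norm x ^ k * c))"
    unfolding design_average_def
    by (auto intro!: sum.cong simp: pos sphere_average_norm_power_mult sphere_average_const sum_distrib_right)
  also have "\<dots> = (\<Sum>x\<in>X. w x * (norm x ^ k * c))"
    using assms(2) by (intro sum.group) auto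
  finally show ?thesis .
qed

lemma homogeneous_polys_0_const:
  assumes "f \<in> homogeneous_polys 0"
  shows "f x = f 0"
  using homogeneous_polys_scaleR[OF assms, of 0 x] by simp

lemma design_average_iff_harmonic:
  fixes X :: "(real ^ 'n::finite) set"
  assumes X: "finite X" "0 \<notin> X"
  shows "(\<forall>f\<in>polys_upto t. design_average X w f = (\<Sum>x\<in>X. w x * f x)) \<longleftrightarrow>
    (\<forall>l j \<phi>. 1 \<le> l \<and> l \<le> t \<and> j \<le> (t - l) div 2 \<and> \<phi> \<in> Harm l \<longrightarrow>
      (\<Sum>x\<in>X. w x * (norm x ^ (2 * j) * \<phi> x)) = 0)" (is "?L \<longleftrightarrow> ?R")
proof
  assume L: ?L
  show ?R
  proof (intro allI impI)
    fix l j and \<phi> :: "real ^ 'n \<Rightarrow> real"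
    assume A: "1 \<le> l \<and> l \<le> t \<and> j \<le> (t - l) div 2 \<and> \<phi> \<in> Harm l"
    then have "(\<lambda>x. norm x ^ (2 * j) * \<phi> x) \<in> homogeneous_polys (2 * j + l)"
      by (intro norm_power_mult_homogeneous) (simp add: Harm_def)
    \<comment> \<open>With \<open>l \<le> t\<close> the subtraction is genuine, and the bound on
      \<open>j\<close> says precisely that the product has degree at most \<open>t\<close>.\<close>
    moreover have "l \<le> t" "j \<le> (t - l) div 2" using A by auto
    then have "2 * j + l \<le> t" by presburger
    ultimately have "(\<lambda>x. norm x ^ (2 * j) * \<phi> x) \<in> polys_upto t"
      using homogeneous_polys_subset_polys_upto by blast
    then show "(\<Sum>x\<in>X. w x * (norm x ^ (2 * j) * \<phi> x)) = 0"
      using L A design_average_harmonic[OF X(2), of \<phi> l w "2 * j"] by metis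
  qed
next
  assume R: ?R
  show ?L
  proof
    fix f :: "real ^ 'n \<Rightarrow> real" assume "f \<in> polys_upto t"
    then obtain h where h: "\<And>l j. 2 * j \<le> l \<Longrightarrow> h l j \<in> Harm (l - 2 * j)"
      and f: "f = (\<lambda>x. \<Sum>(l, j)\<in>(SIGMA l:{..t}. {..l div 2}). norm x ^ (2 * j) * h l j x)"
      using polys_upto_harmonic_decomposition by blast
    define u where "u p x = norm x ^ (2 * snd p) * h (fst p) (snd p) x" for p and x :: "real ^ 'n"
    let ?I = "SIGMA l:{..t}. {..l div 2}"
    have f: "f = (\<lambda>x. \<Sum>p\<in>?I. u p x)"
      unfolding f u_def by (simp add: case_prod_unfold)
    have u: "design_average X w (u p) = (\<Sum>x\<in>X. w x * u p x) \<and> continuous_on UNIV (u p)" if "p \<in> ?I" for p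
    proof -
      obtain l j where p: "p = (l, j)" by (cases p)
      have lj: "l \<le> t" "2 * j \<le> l" using that p by auto
      note harm = h[OF lj(2)]
      have H: "h l j \<in> homogeneous_polys (l - 2 * j)" using harm by (simp add: Harm_def)
      have "design_average X w (\<lambda>x. norm x ^ (2 * j) * h l j x) = (\<Sum>x\<in>X. w x * (norm x ^ (2 * j) * h l j x))"
      proof (cases "l - 2 * j = 0")
        case True
        then have "h l j x = h l j 0" for x
          using homogeneous_polys_0_const[of "h l j" x] H by simp
        then obtain c where c: "h l j = (\<lambda>x. c)" by blast
        show ?thesis
          unfolding c by (rule design_average_norm_power[OF X(2,1)])
      next
        case False
        \<comment> \<open>The hypothesis is used with the harmonic degree \<open>l - 2 * j\<close>
          in place of \<open>l\<close>; the bound on \<open>j\<close> then follows from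
          \<open>l \<le> t\<close>.\<close>
        then have "1 \<le> l - 2 * j \<and> l - 2 * j \<le> t \<and> j \<le> (t - (l - 2 * j)) div 2"
          using lj by auto
        then have "(\<Sum>x\<in>X. w x * (norm x ^ (2 * j) * h l j x)) = 0"
          using R harm by blast
        then show ?thesis
          using False by (simp add: design_average_harmonic[OF X(2) harm])
      qed
      moreover have "continuous_on UNIV (\<lambda>x. norm x ^ (2 * j) * h l j x)"
        by (rule homogeneous_polys_continuous_on[OF norm_power_mult_homogeneous[OF H]])
      ultimately show ?thesis by (simp add: p u_def[abs_def])
    qed
    have "design_average X w f = (\<Sum>p\<in>?I. \<Sum>x\<in>X. w x * u p x)"
      unfolding f using u by (subst design_average_sum[OF X(2)]) auto
    also have "\<dots> = (\<Sum>x\<in>X. w x * f x)"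
      unfolding f by (subst sum.swap) (simp add: sum_distrib_left)
    finally show "design_average X w f = (\<Sum>x\<in>X. w x * f x)" .
  qed
qed

section \<open>Averaging over the group\<close>

text \<open>\<open>W\<close> will be \<open>w y * norm y ^ (2 * j)\<close>, invariant because
  \<open>w\<close> and the norm are; an arbitrary invariant weight treats all \<open>j\<close> at
  once.\<close>

lemma sum_Harm_iff_Harm_inv:
  fixes G :: "(real ^ 'n::finite \<Rightarrow> real ^ 'n) set" and W :: "real ^ 'n \<Rightarrow> real"
  assumes G: "subgroup G orthogonal_group" "finite G"
    and X: "finite X" "\<And>\<sigma>. \<sigma> \<in> G \<Longrightarrow> \<sigma> ` X \<subseteq> X"
    and W: "\<And>\<sigma> y. \<sigma> \<in> G \<Longrightarrow> y \<in> X \<Longrightarrow> W (\<sigma> y) = W y"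
  shows "(\<forall>\<phi>\<in>Harm l. (\<Sum>y\<in>X. W y * \<phi> y) = 0) \<longleftrightarrow> (\<forall>\<phi>\<in>Harm_inv G l. (\<Sum>y\<in>X. W y * \<phi> y) = 0)"
proof
  assume inv: "\<forall>\<phi>\<in>Harm_inv G l. (\<Sum>y\<in>X. W y * \<phi> y) = 0"
  have orth: "orthogonal_transformation \<sigma>" if "\<sigma> \<in> G" for \<sigma>
    using subgroup.subset[OF G(1)] that by (auto simp: orthogonal_group_def)
  show "\<forall>\<phi>\<in>Harm l. (\<Sum>y\<in>X. W y * \<phi> y) = 0"
  proof
    fix \<phi> :: "real ^ 'n \<Rightarrow> real" assume \<phi>: "\<phi> \<in> Harm l"
    \<comment> \<open>The unnormalised average: instead of dividing here, the factor
      \<open>card G\<close> is cancelled at the end. Composing with all \<open>\<sigma>\<close> or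
      with all inverses gives the same sum over a group.\<close>
    define \<psi> where "\<psi> y = (\<Sum>\<sigma>\<in>G. \<phi> (\<sigma> y))" for y
    have \<phi>\<sigma>: "(\<lambda>y. \<phi> (\<sigma> y)) \<in> Harm l" if "\<sigma> \<in> G" for \<sigma>
      by (rule Harm_compose_orthogonal[OF \<phi> orth[OF that]])
    then have H\<sigma>: "(\<lambda>y. \<phi> (\<sigma> y)) \<in> homogeneous_polys l" if "\<sigma> \<in> G" for \<sigma>
      using that by (simp add: Harm_def)
    have "laplacian \<psi> y = 0" for y
      using laplacian_sum[OF G(2) H\<sigma>, where x = y] \<phi>\<sigma> unfolding \<psi>_def[abs_def] by (simp add: Harm_def)
    moreover have "\<psi> \<in> homogeneous_polys l"
      unfolding \<psi>_def[abs_def] by (rule homogeneous_polys_sum[OF H\<sigma>])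
    moreover have "act \<tau> \<psi> = \<psi>" if \<tau>: "\<tau> \<in> G" for \<tau>
    proof
      fix y
      have surj: "surj \<tau>" using orth[OF \<tau>] by (rule orthogonal_transformation_surj)
      \<comment> \<open>Right translation by \<open>\<tau>\<close> permutes \<open>G\<close>:
        surjectivity of \<open>\<tau>\<close> allows cancelling it on the right, and finiteness
        turns injective into bijective. In the reindexed sum \<open>\<tau>\<close> meets its
        inverse.\<close>
      have "inj_on (\<lambda>\<sigma>. \<sigma> \<circ> \<tau>) G"
        using surj by (intro inj_onI) (metis comp_assoc comp_id surj_iff[THEN iffD1])
      moreover have "(\<lambda>\<sigma>. \<sigma> \<circ> \<tau>) ` G \<subseteq> G"
        using subgroup.m_closed[OF G(1) _ \<tau>] by (auto simp: orthogonal_group_def)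
      ultimately have "bij_betw (\<lambda>\<sigma>. \<sigma> \<circ> \<tau>) G G"
        using G(2) by (simp add: bij_betw_def endo_inj_surj)
      then have "(\<Sum>\<sigma>\<in>G. \<phi> ((\<sigma> \<circ> \<tau>) (inv_into UNIV \<tau> y))) = \<psi> (inv_into UNIV \<tau> y)"
        unfolding \<psi>_def by (rule sum.reindex_bij_betw)
      then show "act \<tau> \<psi> y = \<psi> y"
        by (simp add: act_def \<psi>_def surj_f_inv_f[OF surj])
    qed
    ultimately have "\<psi> \<in> Harm_inv G l" by (simp add: Harm_inv_def Harm_def)
    then have "0 = (\<Sum>y\<in>X. W y * \<psi> y)" using inv by simp
    also have "\<dots> = (\<Sum>\<sigma>\<in>G. \<Sum>y\<in>X. W y * \<phi> (\<sigma> y))"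
      unfolding \<psi>_def sum_distrib_left by (rule sum.swap)
    also have "\<dots> = (\<Sum>\<sigma>\<in>G. \<Sum>y\<in>X. W y * \<phi> y)"
    proof (rule sum.cong[OF refl])
      fix \<sigma> assume \<sigma>: "\<sigma> \<in> G"
      have "inj_on \<sigma> X"
        using orthogonal_transformation_inj[OF orth[OF \<sigma>]] by (rule inj_on_subset) simp
      then have "bij_betw \<sigma> X X"
        using X(1) X(2)[OF \<sigma>] by (simp add: bij_betw_def endo_inj_surj)
      then have "(\<Sum>y\<in>X. W (\<sigma> y) * \<phi> (\<sigma> y)) = (\<Sum>y\<in>X. W y * \<phi> y)"
        by (rule sum.reindex_bij_betw)
      then show "(\<Sum>y\<in>X. W y * \<phi> (\<sigma> y)) = (\<Sum>y\<in>X. W y * \<phi> y)"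
        using W[OF \<sigma>] by simp
    qed
    finally have "real (card G) * (\<Sum>y\<in>X. W y * \<phi> y) = 0" by simp
    moreover have "card G \<noteq> 0" using subgroup.one_closed[OF G(1)] G(2) by auto
    ultimately show "(\<Sum>y\<in>X. W y * \<phi> y) = 0" by simp
  qed
qed (simp add: Harm_inv_def)

theorem theorem4p2:
  fixes G :: "(real ^ 'n::finite \<Rightarrow> real ^ 'n) set"
    and t M :: nat
    and r :: "nat \<Rightarrow> real"
    and x :: "nat \<Rightarrow> real ^ 'n"
    and X :: "(real ^ 'n) set"
    and w :: "real ^ 'n \<Rightarrow> real"
  assumes "subgroup G orthogonal_group" and "finite G"
    and "t > 0"
    and "\<And>k. k \<in> {1..M} \<Longrightarrow> x k \<in> sphere 0 1"
    and "\<And>k. k \<in> {1..M} \<Longrightarrow> r k > 0"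
    and "X = (\<Union>k\<in>{1..M}. (*\<^sub>R) (r k) ` G_orbit G (x k))"
    and "\<And>y. y \<in> X \<Longrightarrow> w y > 0"
    and "const_on_orbits G X w"
  shows "invariant_euclidean_design G t X w \<longleftrightarrow>
    (\<forall>l j \<phi>. 1 \<le> l \<and> l \<le> t \<and> j \<le> (t - l) div 2 \<and> \<phi> \<in> Harm_inv G l \<longrightarrow>
      (\<Sum>y\<in>X. w y * norm y ^ (2 * j) * \<phi> y) = 0)"
proof -
  have orth: "orthogonal_transformation \<sigma>" if "\<sigma> \<in> G" for \<sigma>
    using subgroup.subset[OF assms(1)] that by (auto simp: orthogonal_group_def)
  have id: "id \<in> G"
    using subgroup.one_closed[OF assms(1)] by (simp add: orthogonal_group_def)
  have comp: "\<sigma> \<circ> \<tau> \<in> G" if "\<sigma> \<in> G" "\<tau> \<in> G" for \<sigma> \<tau>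
    using subgroup.m_closed[OF assms(1) that] by (simp add: orthogonal_group_def)
  have "G_orbit G y = (\<lambda>\<sigma>. \<sigma> y) ` G" for y
    unfolding G_orbit_def by blast
  then have fin: "finite X" unfolding assms(6) using assms(2) by simp
  \<comment> \<open>At radius 0 the average is a point evaluation, outside the reach of the integral
    lemmas. Orthogonal maps keep \<open>x k\<close> on the unit sphere and \<open>r k\<close> is
    positive.\<close>
  have nonzero: "0 \<notin> X"
  proof
    assume "0 \<in> X"
    then obtain k \<sigma> where k: "k \<in> {1..M}" "\<sigma> \<in> G" "0 = r k *\<^sub>R \<sigma> (x k)"
      unfolding assms(6) G_orbit_def by auto
    then have "norm (\<sigma> (x k)) = 1"
      using assms(4)[OF k(1)] orthogonal_transformation_norm[OF orth[OF k(2)]] by simp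
    then show False using k assms(5)[OF k(1)] by auto
  qed
  have X_inv: "\<sigma> y \<in> X" if \<sigma>: "\<sigma> \<in> G" and "y \<in> X" for \<sigma> y
  proof -
    obtain k \<tau> where k: "k \<in> {1..M}" "\<tau> \<in> G" "y = r k *\<^sub>R \<tau> (x k)"
      using \<open>y \<in> X\<close> unfolding assms(6) G_orbit_def by auto
    have "\<sigma> y = r k *\<^sub>R (\<sigma> \<circ> \<tau>) (x k)"
      using orthogonal_transformation_linear[OF orth[OF \<sigma>]] by (simp add: k linear_scale)
    then show ?thesis
      unfolding assms(6) G_orbit_def using k(1) comp[OF \<sigma> k(2)] by blast
  qed
  have orbit: "G_orbit G y \<subseteq> X" "y \<in> G_orbit G y" if "y \<in> X" for y
    using X_inv that id unfolding G_orbit_def by (auto intro: exI[of _ id])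
  \<comment> \<open>\<open>X\<close> itself serves as the set of orbit representatives, repetitions
    being harmless in a union.\<close>
  then have "X = (\<Union>y\<in>X. G_orbit G y)" by blast
  then have union: "\<exists>Y. X = (\<Union>y\<in>Y. G_orbit G y)" by blast
  have w_inv: "w (\<sigma> y) = w y" if "\<sigma> \<in> G" "y \<in> X" for \<sigma> y
  proof -
    have "w constant_on G_orbit G y"
      using assms(8) orbit(1)[OF that(2)] by (simp add: const_on_orbits_def)
    moreover have "\<sigma> y \<in> G_orbit G y" using that(1) unfolding G_orbit_def by blast
    ultimately show ?thesis using orbit(2)[OF that(2)] unfolding constant_on_def by metis
  qed
  have average: "(\<forall>\<phi>\<in>Harm l. (\<Sum>y\<in>X. w y * norm y ^ (2 * j) * \<phi> y) = 0) \<longleftrightarrow>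
      (\<forall>\<phi>\<in>Harm_inv G l. (\<Sum>y\<in>X. w y * norm y ^ (2 * j) * \<phi> y) = 0)" for l j
    using X_inv w_inv orthogonal_transformation_norm[OF orth]
    by (intro sum_Harm_iff_Harm_inv assms(1,2) fin) auto
  \<comment> \<open>The finiteness, positivity and invariance clauses hold outright for this
    \<open>X\<close> and \<open>w\<close>, so only the design equation is left of statement
    (1).\<close>
  have "invariant_euclidean_design G t X w \<longleftrightarrow>
      (\<forall>f\<in>polys_upto t. design_average X w f = (\<Sum>y\<in>X. w y * f y))"
    using fin assms(7,8) union
    by (simp add: invariant_euclidean_design_def euclidean_design_def design_average_def)
  also have "\<dots> \<longleftrightarrow> (\<forall>l j \<phi>. 1 \<le> l \<and> l \<le> t \<and> j \<le> (t - l) div 2 \<and> \<phi> \<in> Harm l \<longrightarrow>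
      (\<Sum>y\<in>X. w y * norm y ^ (2 * j) * \<phi> y) = 0)"
    unfolding design_average_iff_harmonic[OF fin nonzero] by (simp only: mult.assoc)
  finally show ?thesis using average by blast
qed

end
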